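(* Let $w$ be a weight in $A_{\infty,\mathcal R}$ on $\mathbb{R}^n$. Let $p\ge 1$ and $s>0$, and let $a:\mathcal R\to(0,\infty)$ be a functional satisfying the condition $SD^s_{p,\mathcal R}(w)$ with constant $\|a\|:=\|a\|_{SD^s_{p,\mathcal R}(w)}$. Let $f$ be a locally integrable function such that $$\frac{1}{|R|}\int_{R} |f-P_{R}f|\,dx \le a(R)\qquad\text{for every } R \in \mathcal R .$$ Then there exists a constant $c_n$, depending only on the dimension $n$ (and on the fixed degree $m$ in the definition of $P_R$), such that for every $R\in\mathcal R$, $$\left( \frac{1}{ w(R) } \int_{ R } |f -P_{R}f|^p\,w\,dx\right)^{\frac{1}{p}} \leq c_n (1+s)\max\{\|a\|^s,1\}\,a(R).$$
   Context: $\mathcal R$ is the family of rectangles in $\mathbb{R}^n$, i.e. $n$-fold products of bounded intervals of $\mathbb R$ (sides parallel to the axes). A weight is a nonnegative locally integrable function $w$ on $\mathbb{R}^n$, and $w(E)=\int_E w\,dx$; $|E|$ is Lebesgue measure. Dyadic subrectangles of $R\in\mathcal R$: those obtained from $R$ by successively dividing rectangles into $2^n$ congruent subrectangles by bisecting every side (a descendant of generation $j\ge 0$ has every side equal to $2^{-j}$ times the corresponding side of $R$). Condition $SD^s_{p,\mathcal R}(w)$: there is a constant $c$ such that for every $R\in\mathcal R$ and every family $\{R_i\}_i$ of pairwise disjoint dyadic subrectangles of $R$, $$\Big(\sum_i a(R_i)^p\frac{w(R_i)}{w(R)}\Big)^{1/p}\le c\,\Big(\frac{|\bigcup_i R_i|}{|R|}\Big)^{1/s}a(R).$$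 The infimum of such $c$ is denoted $\|a\|_{SD^s_{p,\mathcal R}(w)}$. For $1<r<\infty$, $w\in A_{r,\mathcal R}$ means $[w]_{A_{r,\mathcal R}}:=\sup_{R\in\mathcal R}\big(\frac1{|R|}\int_R w\big)\big(\frac1{|R|}\int_R w^{-\frac1{r-1}}\big)^{r-1}<\infty$, and $A_{\infty,\mathcal R}=\bigcup_{r>1}A_{r,\mathcal R}$. The polynomial $P_Rf$: fix an integer $m\ge0$ and let $\mathcal P_m$ be the space of polynomials in $n$ variables of degree at most $m$, with inner product $\langle f,g\rangle_R=\frac1{|R|}\int_R fg\,dx$. If $\{\phi_\alpha\}$ is an orthonormal basis of $\mathcal P_m$ for this inner product, then $P_Rf=\sum_\alpha\big(\frac1{|R|}\int_R f\phi_\alpha\,dx\big)\phi_\alpha$. (For $m=0$, $P_Rf=f_R$ is the average of $f$ over $R$.) *)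

theory Defs
  imports "HOL-Analysis.Analysis"
begin

text \<open>
  Sides may be open, closed or half-open. They are required to be nondegenerate,
  since one divides by the measure of a rectangle.
\<close>
definition rectangles :: "(real ^ 'n) set set" where
  "rectangles = {R. \<exists>I :: 'n \<Rightarrow> real set.
     (\<forall>i. is_interval (I i) \<and> bounded (I i) \<and> interior (I i) \<noteq> {}) \<and>
     R = {x. \<forall>i. x $ i \<in> I i}}"

definition mid_side :: "(real ^ 'n) set \<Rightarrow> 'n \<Rightarrow> real" where
  "mid_side R i = (Inf ((\<lambda>x. x $ i) ` R) + Sup ((\<lambda>x. x $ i) ` R)) / 2"

text \<open>
  A child is selected by the set \<open>S\<close> of coordinates in which the lower half is taken.
  The bisecting hyperplane always goes to the upper half, so that the \<open>2 ^ n\<close> children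
  partition the parent and two dyadic subrectangles of \<open>R\<close> are disjoint exactly if their
  interiors are.
\<close>
definition dyadic_child :: "(real ^ 'n) set \<Rightarrow> 'n set \<Rightarrow> (real ^ 'n) set" where
  "dyadic_child R S =
     {x \<in> R. \<forall>i. if i \<in> S then x $ i < mid_side R i else mid_side R i \<le> x $ i}"

inductive_set dyadic_subrects :: "(real ^ 'n) set \<Rightarrow> (real ^ 'n) set set"
  for R :: "(real ^ 'n) set" where
  self: "R \<in> dyadic_subrects R"
| child: "Q \<in> dyadic_subrects R \<Longrightarrow> dyadic_child Q S \<in> dyadic_subrects R"

definition locally_integrable :: "(real ^ 'n \<Rightarrow> real) \<Rightarrow> bool" where
  "locally_integrable f \<longleftrightarrow> (\<forall>K. compact K \<longrightarrow> set_integrable lebesgue K f)"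

definition weight :: "(real ^ 'n \<Rightarrow> real) \<Rightarrow> bool" where
  "weight w \<longleftrightarrow> (\<forall>x. 0 \<le> w x) \<and> locally_integrable w"

definition wmeas :: "(real ^ 'n \<Rightarrow> real) \<Rightarrow> (real ^ 'n) set \<Rightarrow> real" where
  "wmeas w E = (LINT x:E|lebesgue. w x)"

definition avg :: "(real ^ 'n) set \<Rightarrow> (real ^ 'n \<Rightarrow> real) \<Rightarrow> real" where
  "avg R f = (LINT x:R|lebesgue. f x) / measure lebesgue R"

text \<open>
  Finiteness of the supremum includes finiteness of the integrals of \<open>w\<close> to the power
  \<open>- 1 / (r - 1)\<close>. This is spelled out because the Bochner integral of a
  nonintegrable function is \<open>0\<close>, and because \<open>0 powr b = 0\<close> also for
  negative \<open>b\<close>, whereas here a zero of \<open>w\<close> means the value infinity.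
\<close>
definition Ap_rect :: "real \<Rightarrow> (real ^ 'n \<Rightarrow> real) \<Rightarrow> bool" where
  "Ap_rect r w \<longleftrightarrow>
     weight w \<and> (AE x in lebesgue. 0 < w x) \<and>
     (\<forall>R\<in>rectangles. set_integrable lebesgue R (\<lambda>x. w x powr (- 1 / (r - 1)))) \<and>
     bdd_above ((\<lambda>R. avg R w * avg R (\<lambda>x. w x powr (- 1 / (r - 1))) powr (r - 1)) ` rectangles)"

definition Ainf_rect :: "(real ^ 'n \<Rightarrow> real) \<Rightarrow> bool" where
  "Ainf_rect w \<longleftrightarrow> (\<exists>r>1. Ap_rect r w)"

text \<open>The families \<open>D\<close> may be infinite; convergence of the sum is part of the bound.\<close>
definition SD_bound ::
  "real \<Rightarrow> real \<Rightarrow> (real ^ 'n \<Rightarrow> real) \<Rightarrow> ((real ^ 'n) set \<Rightarrow> real) \<Rightarrow> real \<Rightarrow> bool" where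
  "SD_bound s p w a c \<longleftrightarrow>
     (\<forall>R\<in>rectangles. \<forall>D. D \<subseteq> dyadic_subrects R \<and> disjoint D \<longrightarrow>
        (\<lambda>Q. a Q powr p * (wmeas w Q / wmeas w R)) summable_on D \<and>
        (\<Sum>\<^sub>\<infinity>Q\<in>D. a Q powr p * (wmeas w Q / wmeas w R)) powr (1 / p)
          \<le> c * (measure lebesgue (\<Union>D) / measure lebesgue R) powr (1 / s) * a R)"

definition SD ::
  "real \<Rightarrow> real \<Rightarrow> (real ^ 'n \<Rightarrow> real) \<Rightarrow> ((real ^ 'n) set \<Rightarrow> real) \<Rightarrow> bool" where
  "SD s p w a \<longleftrightarrow> (\<exists>c. SD_bound s p w a c)"

definition SD_norm ::
  "real \<Rightarrow> real \<Rightarrow> (real ^ 'n \<Rightarrow> real) \<Rightarrow> ((real ^ 'n) set \<Rightarrow> real) \<Rightarrow> real" where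
  "SD_norm s p w a = Inf {c. SD_bound s p w a c}"

text \<open>Polynomial functions of total degree at most \<open>m\<close>.\<close>
definition polys :: "nat \<Rightarrow> (real ^ 'n \<Rightarrow> real) set" where
  "polys m = {g. \<exists>c :: ('n \<Rightarrow> nat) \<Rightarrow> real.
     g = (\<lambda>x. \<Sum>k | sum k UNIV \<le> m. c k * (\<Prod>i\<in>UNIV. (x $ i) ^ k i))}"

definition orthonormal_basis ::
  "nat \<Rightarrow> (real ^ 'n) set \<Rightarrow> (real ^ 'n \<Rightarrow> real) set \<Rightarrow> bool" where
  "orthonormal_basis m R B \<longleftrightarrow>
     finite B \<and> B \<subseteq> polys m \<and>
     (\<forall>\<phi>\<in>B. \<forall>\<psi>\<in>B. avg R (\<lambda>x. \<phi> x * \<psi> x) = (if \<phi> = \<psi> then 1 else 0)) \<and>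
     (\<forall>g\<in>polys m. \<exists>c. g = (\<lambda>x. \<Sum>\<phi>\<in>B. c \<phi> * \<phi> x))"

text \<open>The result does not depend on the basis chosen.\<close>
definition poly_proj ::
  "nat \<Rightarrow> (real ^ 'n) set \<Rightarrow> (real ^ 'n \<Rightarrow> real) \<Rightarrow> real ^ 'n \<Rightarrow> real" where
  "poly_proj m R f =
     (let B = (SOME B. orthonormal_basis m R B)
      in (\<lambda>x. \<Sum>\<phi>\<in>B. avg R (\<lambda>y. f y * \<phi> y) * \<phi> x))"

end

theory Submission
  imports Defs
begin

text \<open>
  Iterate the Calderon-Zygmund decomposition: starting from \<open>R\<close>, every rectangle \<open>Q\<close> is
  replaced by the maximal dyadic subrectangles on which the average of \<open>\<bar>f - P\<^sub>Q f\<bar>\<close> exceeds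
  \<open>L * a Q\<close>. Off these, \<open>\<bar>f - P\<^sub>Q f\<bar> \<le> L * a Q\<close>, and on each of them, \<open>Q'\<close> say,
  \<open>\<bar>P\<^sub>Q\<^sub>' f - P\<^sub>Q f\<bar> \<le> C * L * a Q\<close>, because \<open>P\<^sub>Q\<^sub>' f - P\<^sub>Q f = P\<^sub>Q\<^sub>' (f - P\<^sub>Q f)\<close> and
  \<open>P\<^sub>Q\<^sub>'\<close> is bounded from \<open>L\<^sup>1\<close> averages to the sup norm, uniformly in the rectangle. Telescoping,
  \<open>\<bar>f - P\<^sub>R f\<bar>\<close> is a.e. at most \<open>C * L\<close> times the sum of \<open>a Q\<close> over the selected rectangles
  \<open>Q\<close> of all generations containing the point. The rectangles of generation \<open>k\<close> are
  disjoint and dyadic in \<open>R\<close>, with union of measure at most \<open>\<bar>R\<bar> / L ^ k\<close>, so the SD condition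
  gives their contribution a norm of at most \<open>\<parallel>a\<parallel> * L powr (- k / s) * a R\<close>. With
  \<open>L = (\<parallel>a\<parallel> * (1 + s) / s) powr s \<le> exp 1 * \<parallel>a\<parallel> powr s\<close> this is at most
  \<open>(s / (1 + s)) ^ k * a R\<close>, and the geometric series sums to \<open>1 + s\<close>.
\<close>

section \<open>Rectangles and their dyadic subrectangles\<close>

text \<open>Records the endpoints of a rectangle and forgets which faces belong to it. Midpoints and
  measure depend on the endpoints alone, so open, closed and half-open sides are treated
  together.\<close>

definition box_bounds :: "(real ^ 'n) set \<Rightarrow> real ^ 'n \<Rightarrow> real ^ 'n \<Rightarrow> bool" where
  "box_bounds R l u \<longleftrightarrow> (\<forall>i. l $ i < u $ i) \<and> box l u \<subseteq> R \<and> R \<subseteq> cbox l u"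

lemma box_boundsD:
  assumes "box_bounds R l u"
  shows "l $ i < u $ i" "box l u \<subseteq> R" "R \<subseteq> cbox l u"
  using assms by (auto simp: box_bounds_def)

text \<open>Each coordinate projection is squeezed between the open and the closed interval with the
  same endpoints, so the \<open>Inf\<close> and \<open>Sup\<close> in \<open>mid_side\<close> are
  the true endpoints.\<close>

lemma box_bounds_proj:
  assumes "box_bounds R l u"
  shows "Inf ((\<lambda>x. x $ i) ` R) = l $ i" "Sup ((\<lambda>x. x $ i) ` R) = u $ i"
proof -
  note B = box_boundsD[OF assms]
  have sub1: "(\<lambda>x. x $ i) ` R \<subseteq> {l $ i .. u $ i}"
    using B(3) by (auto simp: mem_box_cart)
  have sub2: "{l $ i <..< u $ i} \<subseteq> (\<lambda>x. x $ i) ` R"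
  proof
    fix t assume t: "t \<in> {l $ i <..< u $ i}"
    define x where "x = (\<chi> k. if k = i then t else (l $ k + u $ k) / 2)"
    have "x \<in> box l u"
      using t B(1) by (auto simp: mem_box_cart x_def field_simps)
    moreover have "x $ i = t" by (simp add: x_def)
    ultimately show "t \<in> (\<lambda>x. x $ i) ` R" using B(2) by blast
  qed
  have ne: "{l $ i <..< u $ i} \<noteq> {}" using B(1)[of i] by simp
  have bb: "bdd_below {l $ i .. u $ i}" "bdd_above {l $ i .. u $ i}" by auto
  have bb': "bdd_below ((\<lambda>x. x $ i) ` R)" "bdd_above ((\<lambda>x. x $ i) ` R)"
    using bb sub1 bdd_below_mono bdd_above_mono by metis+
  have "Inf ((\<lambda>x. x $ i) ` R) \<le> Inf {l $ i <..< u $ i}"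
    by (rule cInf_superset_mono[OF ne bb'(1) sub2])
  moreover have "Inf {l $ i .. u $ i} \<le> Inf ((\<lambda>x. x $ i) ` R)"
    by (rule cInf_superset_mono[OF _ bb(1) sub1]) (use ne sub2 in blast)
  ultimately show "Inf ((\<lambda>x. x $ i) ` R) = l $ i"
    using B(1)[of i] by simp
  have "Sup {l $ i <..< u $ i} \<le> Sup ((\<lambda>x. x $ i) ` R)"
    by (rule cSup_subset_mono[OF ne bb'(2) sub2])
  moreover have "Sup ((\<lambda>x. x $ i) ` R) \<le> Sup {l $ i .. u $ i}"
    by (rule cSup_subset_mono[OF _ bb(2) sub1]) (use ne sub2 in blast)
  ultimately show "Sup ((\<lambda>x. x $ i) ` R) = u $ i"
    using B(1)[of i] by simp
qed

lemma mid_side_eq: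
  assumes "box_bounds R l u"
  shows "mid_side R i = (l $ i + u $ i) / 2"
  by (simp add: mid_side_def box_bounds_proj[OF assms])

lemma box_bounds_dyadic_child:
  assumes "box_bounds R l u"
  shows "box_bounds (dyadic_child R S)
           (\<chi> i. if i \<in> S then l $ i else (l $ i + u $ i) / 2)
           (\<chi> i. if i \<in> S then (l $ i + u $ i) / 2 else u $ i)"
proof -
  note B = box_boundsD[OF assms]
  let ?l = "\<chi> i. if i \<in> S then l $ i else (l $ i + u $ i) / 2"
  let ?u = "\<chi> i. if i \<in> S then (l $ i + u $ i) / 2 else u $ i"
  have C: "dyadic_child R S = {x \<in> R. \<forall>i. if i \<in> S then x $ i < (l $ i + u $ i) / 2
            else (l $ i + u $ i) / 2 \<le> x $ i}"
    by (simp add: dyadic_child_def mid_side_eq[OF assms])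
  have "box ?l ?u \<subseteq> dyadic_child R S"
  proof
    fix x assume "x \<in> box ?l ?u"
    then have x: "\<And>i. ?l $ i < x $ i \<and> x $ i < ?u $ i" by (auto simp: mem_box_cart)
    have x1: "l $ i < x $ i \<and> x $ i < u $ i \<and>
      (if i \<in> S then x $ i < (l $ i + u $ i) / 2 else (l $ i + u $ i) / 2 \<le> x $ i)" for i
      using x[of i] B(1)[of i] by (cases "i \<in> S") (auto simp: field_simps)
    then have "x \<in> box l u" by (auto simp: mem_box_cart)
    then show "x \<in> dyadic_child R S" unfolding C using B(2) x1 by blast
  qed
  moreover have "dyadic_child R S \<subseteq> cbox ?l ?u"
  proof
    fix x assume "x \<in> dyadic_child R S"
    then have x: "x \<in> cbox l u" and xS: "\<And>i. if i \<in> S then x $ i < (l $ i + u $ i) / 2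
            else (l $ i + u $ i) / 2 \<le> x $ i"
      using B(3) unfolding C by blast+
    have "?l $ i \<le> x $ i \<and> x $ i \<le> ?u $ i" for i
      using x xS[of i] by (cases "i \<in> S") (auto simp: mem_box_cart)
    then show "x \<in> cbox ?l ?u" by (simp add: mem_box_cart)
  qed
  ultimately show ?thesis
    using B(1) by (simp add: box_bounds_def)
qed

lemma rectanglesE:
  assumes "R \<in> rectangles"
  obtains I where "\<And>i. is_interval (I i)" "\<And>i. bounded (I i)" "\<And>i. interior (I i) \<noteq> {}"
    "R = {x. \<forall>i. x $ i \<in> I i}"
proof -
  obtain I where I: "(\<forall>i. is_interval (I i) \<and> bounded (I i) \<and> interior (I i) \<noteq> {}) \<and>
     R = {x. \<forall>i. x $ i \<in> I i}"
    using assms unfolding rectangles_def mem_Collect_eq by (elim exE) (rule that)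
  show thesis using I by (intro that[of I]) auto
qed

text \<open>The endpoints are \<open>Inf\<close> and \<open>Sup\<close> of each side. A ball inside
  the side makes them distinct, and an interval contains everything strictly between them.\<close>

lemma rectangles_box_bounds:
  assumes "R \<in> rectangles"
  obtains l u where "box_bounds R l u"
proof -
  obtain I where I: "\<And>i. is_interval (I i)" "\<And>i. bounded (I i)" "\<And>i. interior (I i) \<noteq> {}"
    and R: "R = {x. \<forall>i. x $ i \<in> I i}"
    by (rule rectanglesE[OF assms]) (rule that; assumption)
  have *: "\<exists>a b. a < b \<and> {a<..<b} \<subseteq> I i \<and> I i \<subseteq> {a..b}" for i
  proof -
    have bd: "bdd_below (I i)" "bdd_above (I i)"
      using I(2) bounded_imp_bdd_below bounded_imp_bdd_above by auto
    obtain x e where e: "e > 0" "ball x e \<subseteq> I i" using I(3)[of i] by (auto simp: mem_interior)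
    have x: "x \<in> I i" "x + e / 2 \<in> I i" using e by (auto simp: subset_iff dist_real_def)
    have "Inf (I i) \<le> x" using bd x(1) by (simp add: cInf_lower)
    moreover have "x + e/2 \<le> Sup (I i)" using bd x(2) by (simp add: cSup_upper)
    ultimately have lt: "Inf (I i) < Sup (I i)" using e(1) by linarith
    have "{Inf (I i)<..<Sup (I i)} \<subseteq> I i"
    proof
      fix t assume t: "t \<in> {Inf (I i)<..<Sup (I i)}"
      have ne: "I i \<noteq> {}" using x by auto
      obtain a where "a \<in> I i" "a < t" using t ne bd by (auto simp: cInf_less_iff)
      moreover obtain b where "b \<in> I i" "t < b" using t ne bd by (auto simp: less_cSup_iff)
      ultimately show "t \<in> I i" using I(1)[of i] by (meson is_interval_1 less_imp_le)
    qed
    moreover have "I i \<subseteq> {Inf (I i)..Sup (I i)}"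
      using bd by (auto intro: cInf_lower cSup_upper)
    ultimately show ?thesis using lt by blast
  qed
  then obtain a b where ab: "\<And>i. a i < b i" "\<And>i. {a i<..<b i} \<subseteq> I i" "\<And>i. I i \<subseteq> {a i..b i}"
    by metis
  have "box_bounds R (\<chi> i. a i) (\<chi> i. b i)"
    using ab unfolding box_bounds_def R by (fastforce simp: mem_box_cart)
  then show ?thesis using that by blast
qed

text \<open>The delicate clause is that the halved sides keep a nonempty interior; it is read off
  from the endpoints of the child, through points of its open box.\<close>

lemma dyadic_child_rectangle:
  assumes "R \<in> rectangles"
  shows "dyadic_child R S \<in> rectangles"
proof -
  obtain l u where lu: "box_bounds R l u" using rectangles_box_bounds[OF assms] .
  obtain I where I: "\<And>i. is_interval (I i)" "\<And>i. bounded (I i)" "\<And>i. interior (I i) \<noteq> {}"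
    and R: "R = {x. \<forall>i. x $ i \<in> I i}"
    by (rule rectanglesE[OF assms]) (rule that; assumption)
  define J where "J i = I i \<inter> (if i \<in> S then {..<mid_side R i} else {mid_side R i..})" for i
  have eq: "dyadic_child R S = {x. \<forall>i. x $ i \<in> J i}"
    unfolding dyadic_child_def J_def by (subst R) auto
  have "is_interval (J i)" "bounded (J i)" for i
    unfolding J_def using I(1,2)[of i] by (auto simp: is_interval_1 intro: bounded_Int)
  moreover have "interior (J i) \<noteq> {}" for i
  proof -
    obtain l' u' where B: "box_bounds (dyadic_child R S) l' u'"
      using box_bounds_dyadic_child[OF lu] by blast
    have "{l' $ i<..<u' $ i} \<subseteq> J i"
    proof
      fix t assume t: "t \<in> {l' $ i<..<u' $ i}"
      have "(\<chi> k. if k = i then t else (l' $ k + u' $ k) / 2) \<in> box l' u'"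
        using t box_boundsD(1)[OF B] by (auto simp: mem_box_cart field_simps)
      then have "(\<chi> k. if k = i then t else (l' $ k + u' $ k) / 2) \<in> dyadic_child R S"
        using box_boundsD(2)[OF B] by blast
      then show "t \<in> J i" unfolding eq by (auto dest: spec[of _ i])
    qed
    then have "{l' $ i<..<u' $ i} \<subseteq> interior (J i)" by (simp add: interior_maximal)
    moreover have "{l' $ i<..<u' $ i} \<noteq> {}" using box_boundsD(1)[OF B, of i] by simp
    ultimately show ?thesis by blast
  qed
  ultimately show ?thesis unfolding eq rectangles_def
    by (intro CollectI exI[of _ J] conjI allI refl)
qed

text \<open>All sets between the open and the closed box differ by a subset of the frontier, which
  is negligible.\<close>

lemma box_bounds_measure:
  fixes R :: "(real ^ 'n) set"
  assumes "box_bounds R l u"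
  shows "R \<in> lmeasurable" "measure lebesgue R = (\<Prod>i\<in>UNIV. u $ i - l $ i)"
    "sym_diff R (cbox l u) \<in> null_sets lebesgue"
proof -
  note B = box_boundsD[OF assms]
  have "negligible (cbox l u - box l u)" by (rule negligible_frontier_interval)
  then have neg: "negligible (sym_diff R (cbox l u))"
    by (rule negligible_subset) (use B in auto)
  then show "sym_diff R (cbox l u) \<in> null_sets lebesgue" by (simp add: negligible_iff_null_sets)
  have neg': "negligible (sym_diff (cbox l u) R)" using neg by (simp add: Un_commute)
  show "R \<in> lmeasurable" by (rule lmeasurable_negligible_symdiff[OF lmeasurable_cbox neg'])
  have ne: "cbox l u \<noteq> {}"
    using B(1) by (auto simp: interval_eq_empty_cart not_less less_imp_le)
  have "measure lebesgue R = measure lebesgue (cbox l u)"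
    by (rule measure_negligible_symdiff[OF _ neg']) auto
  also have "\<dots> = (\<Prod>i\<in>UNIV. u $ i - l $ i)"
    using ne by (simp add: content_cbox_cart)
  finally show "measure lebesgue R = (\<Prod>i\<in>UNIV. u $ i - l $ i)" .
qed

lemma rectangles_measure:
  assumes "R \<in> rectangles"
  shows "R \<in> lmeasurable" "0 < measure lebesgue R" "bounded R"
proof -
  obtain l u where B: "box_bounds R l u" using rectangles_box_bounds[OF assms] .
  show "R \<in> lmeasurable" using box_bounds_measure[OF B] by simp
  show "0 < measure lebesgue R" unfolding box_bounds_measure(2)[OF B]
    using box_boundsD(1)[OF B] by (intro prod_pos) auto
  show "bounded R" using box_boundsD(3)[OF B] bounded_cbox bounded_subset by blast
qed

lemma measure_dyadic_child:
  fixes R :: "(real ^ 'n) set"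
  assumes "R \<in> rectangles"
  shows "measure lebesgue (dyadic_child R S) = measure lebesgue R / 2 ^ CARD('n)"
proof -
  obtain l u where B: "box_bounds R l u" using rectangles_box_bounds[OF assms] .
  have "measure lebesgue (dyadic_child R S) = (\<Prod>i\<in>UNIV. (u $ i - l $ i) / 2)"
    unfolding box_bounds_measure(2)[OF box_bounds_dyadic_child[OF B, of S]]
    by (intro prod.cong) (auto simp: field_simps)
  then show ?thesis by (simp add: prod_dividef box_bounds_measure(2)[OF B])
qed

section \<open>Dyadic descendants containing a given point\<close>

text \<open>In each coordinate the half containing \<open>x\<close> is taken, so for
  \<open>x\<close> in \<open>R\<close> this is the chain of dyadic subrectangles shrinking to
  \<open>x\<close>, one for each generation \<open>j\<close>.\<close>

fun dyadic_at :: "(real ^ 'n) set \<Rightarrow> nat \<Rightarrow> real ^ 'n \<Rightarrow> (real ^ 'n) set" where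
  "dyadic_at R 0 x = R"
| "dyadic_at R (Suc j) x =
     dyadic_child (dyadic_at R j x) {i. x $ i < mid_side (dyadic_at R j x) i}"

lemma dyadic_subrects_rectangle:
  assumes "Q \<in> dyadic_subrects R" "R \<in> rectangles"
  shows "Q \<in> rectangles"
  using assms by induction (auto simp: dyadic_child_rectangle)

lemma dyadic_subrects_subset:
  assumes "Q \<in> dyadic_subrects R" shows "Q \<subseteq> R"
  using assms by induction (auto simp: dyadic_child_def)

lemma dyadic_subrects_trans:
  assumes "Q' \<in> dyadic_subrects Q" "Q \<in> dyadic_subrects R"
  shows "Q' \<in> dyadic_subrects R"
  using assms by induction (auto intro: dyadic_subrects.intros)

text \<open>A descendant is reached by a finite word over the finite type of coordinate sets, and
  there are countably many such words.\<close>

lemma countable_dyadic_subrects: "countable (dyadic_subrects R)"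
proof (rule countable_subset)
  show "dyadic_subrects R \<subseteq> range (foldl dyadic_child R)"
  proof
    fix Q assume "Q \<in> dyadic_subrects R"
    then show "Q \<in> range (foldl dyadic_child R)"
    proof induction
      case self
      show ?case by (rule range_eqI[of _ _ "[]"]) simp
    next
      case (child Q S)
      then obtain xs where "Q = foldl dyadic_child R xs" by auto
      then show ?case by (intro range_eqI[of _ _ "xs @ [S]"]) simp
    qed
  qed
qed (rule countable_image, simp)

lemma dyadic_at_subrect: "dyadic_at R j x \<in> dyadic_subrects R"
  by (induction j) (auto intro: dyadic_subrects.intros)

lemma mem_dyadic_at: "x \<in> R \<Longrightarrow> x \<in> dyadic_at R j x"
  by (induction j) (auto simp: dyadic_child_def)

lemma dyadic_at_antimono: "i \<le> j \<Longrightarrow> dyadic_at R j x \<subseteq> dyadic_at R i x"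
  by (induction j) (auto simp: le_Suc_eq dyadic_child_def)

text \<open>Membership in a child fixes the half taken in every coordinate, so \<open>y\<close>
  follows the same path as \<open>x\<close>. Thus two members of one generation that meet
  coincide.\<close>

lemma dyadic_at_eq: "y \<in> dyadic_at R j x \<Longrightarrow> dyadic_at R j y = dyadic_at R j x"
proof (induction j)
  case (Suc j)
  let ?Q = "dyadic_at R j x"
  have y: "y \<in> ?Q" "\<And>i. (y $ i < mid_side ?Q i) \<longleftrightarrow> (x $ i < mid_side ?Q i)"
    using Suc.prems unfolding dyadic_at.simps dyadic_child_def mem_Collect_eq not_less[symmetric]
    by (blast, meson)
  then show ?case using Suc.IH by simp
qed simp

text \<open>Each bisection halves all sides, so the l1 diameter at generation \<open>j\<close> is at
  most the sum of the sides of \<open>R\<close> over \<open>2 ^ j\<close>, and it dominates the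
  Euclidean diameter.\<close>

lemma dyadic_at_small:
  assumes "R \<in> rectangles" and x: "x \<in> R" and e: "e > 0"
  obtains j where "dyadic_at R j x \<subseteq> ball x e"
proof -
  obtain l u where B: "box_bounds R l u" using rectangles_box_bounds[OF assms(1)] .
  have ex: "\<exists>l' u'. box_bounds (dyadic_at R j x) l' u' \<and> (\<forall>i. u' $ i - l' $ i = (u $ i - l $ i) / 2 ^ j)" for j
  proof (induction j)
    case 0 then show ?case using B by auto
  next
    case (Suc j)
    then obtain l' u' where B': "box_bounds (dyadic_at R j x) l' u'"
      and d: "\<And>i. u' $ i - l' $ i = (u $ i - l $ i) / 2 ^ j" by blast
    let ?S = "{i. x $ i < mid_side (dyadic_at R j x) i}"
    show ?case
    proof (intro exI conjI allI)
      show "box_bounds (dyadic_at R (Suc j) x)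
           (\<chi> i. if i \<in> ?S then l' $ i else (l' $ i + u' $ i) / 2)
           (\<chi> i. if i \<in> ?S then (l' $ i + u' $ i) / 2 else u' $ i)"
        unfolding dyadic_at.simps by (rule box_bounds_dyadic_child[OF B'])
      fix i
      have "(\<chi> i. if i \<in> ?S then (l' $ i + u' $ i) / 2 else u' $ i) $ i -
           (\<chi> i. if i \<in> ?S then l' $ i else (l' $ i + u' $ i) / 2) $ i = (u' $ i - l' $ i) / 2"
        by (simp add: field_simps)
      then show "(\<chi> i. if i \<in> ?S then (l' $ i + u' $ i) / 2 else u' $ i) $ i -
           (\<chi> i. if i \<in> ?S then l' $ i else (l' $ i + u' $ i) / 2) $ i = (u $ i - l $ i) / 2 ^ Suc j"
        by (simp add: d)
    qed
  qed
  have "(\<lambda>j. (\<Sum>i\<in>UNIV. u $ i - l $ i) / 2 ^ j) \<longlonglongrightarrow> 0"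
    by (rule LIMSEQ_divide_realpow_zero) simp
  then have "\<forall>\<^sub>F j in sequentially. (\<Sum>i\<in>UNIV. u $ i - l $ i) / 2 ^ j < e"
    using e by (rule order_tendstoD)
  then obtain j where j: "(\<Sum>i\<in>UNIV. u $ i - l $ i) / 2 ^ j < e"
    by (auto simp: eventually_sequentially)
  obtain l' u' where B': "box_bounds (dyadic_at R j x) l' u'"
      and d: "\<And>i. u' $ i - l' $ i = (u $ i - l $ i) / 2 ^ j" using ex by blast
  have "dyadic_at R j x \<subseteq> ball x e"
  proof
    fix y assume "y \<in> dyadic_at R j x"
    then have y: "y \<in> cbox l' u'" and x': "x \<in> cbox l' u'"
      using box_boundsD(3)[OF B'] mem_dyadic_at[OF x] by auto
    have "norm (x - y) \<le> (\<Sum>i\<in>UNIV. \<bar>(x - y) $ i\<bar>)" by (rule norm_le_l1_cart)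
    also have "\<dots> \<le> (\<Sum>i\<in>UNIV. u' $ i - l' $ i)"
      using x' y by (intro sum_mono) (auto simp: mem_box_cart abs_le_iff, (smt (verit))+)
    also have "\<dots> < e" using j by (simp add: d sum_divide_distrib)
    finally show "y \<in> ball x e" by (simp add: dist_norm)
  qed
  then show ?thesis using that by blast
qed

section \<open>Maximal dyadic subrectangles with a given property\<close>

text \<open>Maximality is encoded as stopping: in the chain of each point, the first rectangle
  satisfying \<open>P\<close> is taken.\<close>

definition maximal_dyadic :: "(real ^ 'n) set \<Rightarrow> ((real ^ 'n) set \<Rightarrow> bool) \<Rightarrow> (real ^ 'n) set set" where
  "maximal_dyadic R P =
     (\<lambda>x. dyadic_at R (LEAST j. P (dyadic_at R j x)) x) ` {x \<in> R. \<exists>j. P (dyadic_at R j x)}"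

lemma maximal_dyadic_subrects: "maximal_dyadic R P \<subseteq> dyadic_subrects R"
  by (auto simp: maximal_dyadic_def dyadic_at_subrect)

lemma Union_maximal_dyadic: "\<Union> (maximal_dyadic R P) = {x \<in> R. \<exists>j. P (dyadic_at R j x)}" (is "_ = ?X")
proof
  show "\<Union> (maximal_dyadic R P) \<subseteq> ?X"
  proof
    fix y assume "y \<in> \<Union> (maximal_dyadic R P)"
    then obtain x where x: "\<exists>j. P (dyadic_at R j x)"
      and y: "y \<in> dyadic_at R (LEAST j. P (dyadic_at R j x)) x"
      by (auto simp: maximal_dyadic_def)
    have "P (dyadic_at R (LEAST j. P (dyadic_at R j x)) x)" using x by (rule LeastI_ex)
    then show "y \<in> ?X"
      using y dyadic_at_eq[OF y] dyadic_subrects_subset[OF dyadic_at_subrect] by (metis (no_types, lifting) mem_Collect_eq subsetD)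
  qed
  show "?X \<subseteq> \<Union> (maximal_dyadic R P)"
    unfolding maximal_dyadic_def using mem_dyadic_at by fastforce
qed

text \<open>All points of a selected rectangle have the same chain up to the stopping generation,
  hence stop there too and select the same rectangle.\<close>

lemma disjoint_maximal_dyadic: "disjoint (maximal_dyadic R P)"
proof -
  have *: "dyadic_at R (LEAST j. P (dyadic_at R j x)) x = dyadic_at R (LEAST j. P (dyadic_at R j z)) z"
    if x: "\<exists>j. P (dyadic_at R j x)" and z: "z \<in> dyadic_at R (LEAST j. P (dyadic_at R j x)) x" for x z
  proof -
    let ?j = "LEAST j. P (dyadic_at R j x)"
    have eq: "dyadic_at R i z = dyadic_at R i x" if "i \<le> ?j" for i
      using dyadic_at_antimono[OF that] z by (intro dyadic_at_eq) blast
    have "P (dyadic_at R ?j x)" using x by (rule LeastI_ex)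
    then have "(LEAST j. P (dyadic_at R j z)) = ?j"
      using eq by (intro Least_equality) (auto, metis not_less_Least linorder_not_le nle_le)
    then show ?thesis using eq by simp
  qed
  have "A = A'" if "A \<in> maximal_dyadic R P" "A' \<in> maximal_dyadic R P" "z \<in> A" "z \<in> A'" for A A' z
  proof -
    obtain x y where "\<exists>j. P (dyadic_at R j x)" "A = dyadic_at R (LEAST j. P (dyadic_at R j x)) x"
      "\<exists>j. P (dyadic_at R j y)" "A' = dyadic_at R (LEAST j. P (dyadic_at R j y)) y"
      using \<open>A \<in> _\<close> \<open>A' \<in> _\<close> unfolding maximal_dyadic_def by blast
    then show ?thesis using *[of x z] *[of y z] that(3,4) by metis
  qed
  then show ?thesis unfolding disjoint_def by blast
qed

lemma maximal_dyadicD: "Q \<in> maximal_dyadic R P \<Longrightarrow> P Q"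
  by (auto simp: maximal_dyadic_def intro: LeastI_ex)

text \<open>Failure of \<open>P\<close> at \<open>R\<close> makes the stopping index positive, and
  the preceding member of the chain fails \<open>P\<close> by minimality. This serves to bound
  averages on a selected rectangle by those on its parent.\<close>

lemma maximal_dyadic_parent:
  assumes "Q \<in> maximal_dyadic R P" "\<not> P R"
  obtains Q' S where "Q' \<in> dyadic_subrects R" "\<not> P Q'" "Q = dyadic_child Q' S"
proof -
  obtain x where x: "\<exists>j. P (dyadic_at R j x)"
      and Q: "Q = dyadic_at R (LEAST j. P (dyadic_at R j x)) x"
    using assms(1) by (auto simp: maximal_dyadic_def)
  let ?j = "LEAST j. P (dyadic_at R j x)"
  have "P (dyadic_at R ?j x)" using x by (rule LeastI_ex)
  then have "?j \<noteq> 0" using assms(2) by (metis dyadic_at.simps(1))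
  then obtain k where k: "?j = Suc k" using not0_implies_Suc by blast
  have "\<not> P (dyadic_at R k x)" using not_less_Least[of k "\<lambda>j. P (dyadic_at R j x)"] k by simp
  then show ?thesis
    using that[OF dyadic_at_subrect] Q unfolding k by simp
qed

section \<open>Polynomials\<close>

abbreviation monomial :: "('n \<Rightarrow> nat) \<Rightarrow> real ^ 'n \<Rightarrow> real" where
  "monomial k \<equiv> (\<lambda>x. \<Prod>i\<in>UNIV. (x $ i) ^ k i)"

text \<open>\<open>sum\<close> over an infinite set is 0, so the sums in \<open>polys\<close> have
  their intended meaning only because each exponent is bounded by the total degree.\<close>

lemma finite_exponents: "finite {k :: 'n::finite \<Rightarrow> nat. sum k UNIV \<le> m}"
proof (rule finite_subset)
  have "k i \<le> sum k UNIV" for k :: "'n \<Rightarrow> nat" and i by (intro member_le_sum) auto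
  then show "{k :: 'n \<Rightarrow> nat. sum k UNIV \<le> m} \<subseteq> (UNIV :: 'n set) \<rightarrow>\<^sub>E {..m}"
    by (auto simp: PiE_def Pi_def intro: le_trans)
qed (intro finite_PiE; simp)

lemma polysI: "(\<lambda>x. \<Sum>k | sum k UNIV \<le> m. c k * monomial k x) \<in> polys m"
  unfolding polys_def by blast

lemma polysE:
  assumes "g \<in> polys m"
  obtains c where "g = (\<lambda>x. \<Sum>k | sum k UNIV \<le> m. c k * monomial k x)"
  using assms unfolding polys_def by blast

lemma polys_add: 
  assumes "f \<in> polys m" "g \<in> polys m" shows "(\<lambda>x. f x + g x) \<in> polys m"
proof -
  obtain c where c: "f = (\<lambda>x. \<Sum>k | sum k UNIV \<le> m. c k * monomial k x)" using assms(1) by (rule polysE)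
  obtain d where d: "g = (\<lambda>x. \<Sum>k | sum k UNIV \<le> m. d k * monomial k x)" using assms(2) by (rule polysE)
  have "(\<lambda>x. f x + g x) = (\<lambda>x. \<Sum>k | sum k UNIV \<le> m. (c k + d k) * monomial k x)"
    by (simp add: c d sum.distrib distrib_right)
  then show ?thesis using polysI by simp
qed

lemma polys_cmult:
  assumes "f \<in> polys m" shows "(\<lambda>x. b * f x) \<in> polys m"
proof -
  obtain c where "f = (\<lambda>x. \<Sum>k | sum k UNIV \<le> m. c k * monomial k x)"
    using assms by (rule polysE)
  then have "(\<lambda>x. b * f x) = (\<lambda>x. \<Sum>k | sum k UNIV \<le> m. (b * c k) * monomial k x)"
    by (simp add: sum_distrib_left mult.assoc)
  then show ?thesis using polysI by simp
qed

lemma polys_0: "(\<lambda>x. 0) \<in> polys m"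
  using polysI[of "\<lambda>_. 0" m] by simp

lemma polys_diff:
  assumes "f \<in> polys m" "g \<in> polys m" shows "(\<lambda>x. f x - g x) \<in> polys m"
  using polys_add[OF assms(1) polys_cmult[OF assms(2), of "-1"]] by simp

lemma polys_sum:
  assumes "\<And>i. i \<in> A \<Longrightarrow> f i \<in> polys m" shows "(\<lambda>x. \<Sum>i\<in>A. f i x) \<in> polys m"
  using assms by (induction A rule: infinite_finite_induct) (auto simp: polys_0 intro: polys_add)

lemma polys_monomial:
  assumes "sum k UNIV \<le> m" shows "monomial k \<in> polys m"
proof -
  have "(\<Sum>k' | sum k' UNIV \<le> m. (if k' = k then 1 else 0) * monomial k' x) = monomial k x" for x :: "real ^ 'a"
    using assms by (simp add: if_distrib [of "\<lambda>a. a * _"] finite_exponents cong: if_cong)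
  then show ?thesis using polysI[of "\<lambda>k'. if k' = k then 1 else 0" m] by simp
qed

lemma polys_mono: assumes "g \<in> polys m" "m \<le> m'" shows "g \<in> polys m'"
proof -
  obtain c where "g = (\<lambda>x. \<Sum>k | sum k UNIV \<le> m. c k * monomial k x)" using assms(1) by (rule polysE)
  then show ?thesis using assms(2) by (auto intro!: polys_sum polys_cmult polys_monomial)
qed

lemma polys_mult:
  fixes f g :: "real ^ 'n \<Rightarrow> real"
  assumes "f \<in> polys m" "g \<in> polys m'" shows "(\<lambda>x. f x * g x) \<in> polys (m + m')"
proof -
  obtain c where c: "f = (\<lambda>x. \<Sum>k | sum k UNIV \<le> m. c k * monomial k x)" using assms(1) by (rule polysE)
  obtain d where d: "g = (\<lambda>x. \<Sum>k | sum k UNIV \<le> m'. d k * monomial k x)" using assms(2) by (rule polysE)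
  have "(\<lambda>x. monomial k x * monomial k' x) \<in> polys (m + m')"
    if "sum k UNIV \<le> m" "sum k' UNIV \<le> m'" for k k' :: "'n \<Rightarrow> nat"
  proof -
    have "(\<lambda>x::real^'n. monomial k x * monomial k' x) = monomial (\<lambda>i. k i + k' i)"
      by (simp add: power_add prod.distrib)
    then show ?thesis using that by (simp only:) (rule polys_monomial, simp add: sum.distrib)
  qed
  then have "(\<lambda>x. \<Sum>k | sum k UNIV \<le> m. \<Sum>k' | sum k' UNIV \<le> m'.
      (c k * d k') * (monomial k x * monomial k' x)) \<in> polys (m + m')"
    by (intro polys_sum polys_cmult) auto
  also have "(\<lambda>x. \<Sum>k | sum k UNIV \<le> m. \<Sum>k' | sum k' UNIV \<le> m'.
      (c k * d k') * (monomial k x * monomial k' x)) = (\<lambda>x. f x * g x)"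
    unfolding c d sum_product by (intro ext sum.cong refl) (simp add: mult_ac)
  finally show ?thesis .
qed

lemma polys_const: "(\<lambda>x. b) \<in> polys m"
  using polys_cmult[OF polys_monomial[of "\<lambda>_. 0" m], of b] by simp

lemma polys_affine: "(\<lambda>x :: real ^ 'n. a + b * x $ i) \<in> polys 1"
proof -
  have "monomial (\<lambda>j. if j = i then 1 else 0) = (\<lambda>x :: real ^ 'n. x $ i)"
    by (simp add: if_distrib [of "\<lambda>a. _ ^ a"] cong: if_cong)
  moreover have "monomial (\<lambda>j. if j = i then 1 else 0) \<in> (polys 1 :: (real ^ 'n \<Rightarrow> real) set)"
    by (rule polys_monomial) simp
  ultimately show ?thesis
    by (intro polys_add polys_const polys_cmult) simp
qed

lemma polys_power: "g \<in> polys m \<Longrightarrow> (\<lambda>x. g x ^ j) \<in> polys (m * j)"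
proof (induction j)
  case (Suc j)
  then show ?case using polys_mult[OF Suc.prems Suc.IH] by (simp add: algebra_simps)
qed (simp add: polys_const)

lemma polys_prod:
  assumes "finite A" "\<And>i. i \<in> A \<Longrightarrow> g i \<in> polys (k i)"
  shows "(\<lambda>x. \<Prod>i\<in>A. g i x) \<in> polys (sum k A)"
  using assms by (induction A) (auto simp: polys_const intro: polys_mult)

text \<open>A separate affine map in each coordinate does not raise the degree of any factor. This
  is the change of variables between a rectangle and the unit cube.\<close>

lemma polys_compose_affine:
  fixes g :: "real ^ 'n \<Rightarrow> real"
  assumes "g \<in> polys m"
  shows "(\<lambda>x. g (\<chi> i. a i + b i * x $ i)) \<in> polys m"
proof -
  obtain c where c: "g = (\<lambda>x. \<Sum>k | sum k UNIV \<le> m. c k * monomial k x)" using assms by (rule polysE)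
  have "(\<lambda>x::real^'n. \<Prod>i\<in>UNIV. (a i + b i * x $ i) ^ k i) \<in> polys m" if "sum k UNIV \<le> m" for k
  proof -
    have "(\<lambda>x::real^'n. \<Prod>i\<in>UNIV. (a i + b i * x $ i) ^ k i) \<in> polys (\<Sum>i\<in>UNIV. 1 * k i)"
      by (intro polys_prod polys_power polys_affine) simp
    then show ?thesis using polys_mono that by simp
  qed
  then show ?thesis unfolding c by (auto intro!: polys_sum polys_cmult)
qed

lemma polys_continuous: "g \<in> polys m \<Longrightarrow> continuous_on S g"
  by (erule polysE) (auto intro!: continuous_intros)

lemma polys_measurable [measurable]: "g \<in> polys m \<Longrightarrow> g \<in> borel_measurable borel"
  by (rule borel_measurable_continuous_onI[OF polys_continuous])

lemma poly_zero_if_infinite_roots: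
  fixes q :: "real poly"
  assumes "infinite {t. poly q t = 0}" shows "q = 0"
  using assms poly_roots_finite by blast

text \<open>Restricted to a line, \<open>g\<close> becomes a univariate polynomial with infinitely many roots.\<close>
lemma polys_eq_zero:
  fixes g :: "real ^ 'n \<Rightarrow> real"
  assumes g: "g \<in> polys m" and U: "open U" "U \<noteq> {}" and z: "\<And>x. x \<in> U \<Longrightarrow> g x = 0"
  shows "g x = 0"
proof -
  obtain c where c: "g = (\<lambda>x. \<Sum>k | sum k UNIV \<le> m. c k * monomial k x)" using g by (rule polysE)
  obtain x0 where x0: "x0 \<in> U" using U by blast
  \<comment> \<open>\<open>q\<close> is \<open>g\<close> along the line through \<open>x0\<close>
    and \<open>x\<close>, which are the points with parameter 0 and 1.\<close>
  define q where "q = (\<Sum>k | sum k UNIV \<le> m. [:c k:] * (\<Prod>i\<in>UNIV. [:x0 $ i, x $ i - x0 $ i:] ^ k i))"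
  have q: "poly q t = g (x0 + t *\<^sub>R (x - x0))" for t
    by (simp add: q_def c poly_sum poly_prod)
  have "((\<lambda>t. x0 + t *\<^sub>R (x - x0)) \<longlongrightarrow> x0 + 0 *\<^sub>R (x - x0)) (at 0)"
    by (intro tendsto_intros)
  then have "\<forall>\<^sub>F t in at 0. x0 + t *\<^sub>R (x - x0) \<in> U"
    using U x0 by (intro topological_tendstoD) auto
  then obtain d where d: "d > 0" "\<And>t. t \<noteq> 0 \<Longrightarrow> dist t 0 < d \<Longrightarrow> x0 + t *\<^sub>R (x - x0) \<in> U"
    unfolding eventually_at by blast
  have "{0<..<d} \<subseteq> {t. poly q t = 0}" using d z by (auto simp: q)
  moreover have "infinite {0<..<d}" using d by simp
  ultimately have "infinite {t. poly q t = 0}" using finite_subset by blast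
  then have "poly q 1 = 0" using poly_zero_if_infinite_roots by force
  then show ?thesis by (simp add: q)
qed

section \<open>The projection onto polynomials\<close>

lemma rectangle_sets [measurable]: "R \<in> rectangles \<Longrightarrow> R \<in> sets lebesgue"
  using rectangles_measure(1) by blast

lemma rectangle_subset_cbox:
  assumes "R \<in> rectangles" obtains l u where "R \<subseteq> cbox l u"
  using assms by (meson bounded_subset_cbox_symmetric rectangles_measure(3))

lemma set_integrable_polys:
  assumes "R \<in> rectangles" "g \<in> polys m"
  shows "set_integrable lebesgue R g"
proof -
  obtain l u where "R \<subseteq> cbox l u" using rectangle_subset_cbox[OF assms(1)] .
  then show ?thesis
    using set_integrable_subset[OF absolutely_integrable_continuous[OF polys_continuous[OF assms(2)]]] assms(1)
    by (meson rectangle_sets)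
qed

lemma polys_bounded_on_rectangle:
  assumes "R \<in> rectangles" "g \<in> polys m"
  shows "bounded (g ` R)"
proof -
  obtain l u where "R \<subseteq> cbox l u" using rectangle_subset_cbox[OF assms(1)] .
  moreover have "bounded (g ` cbox l u)"
    using compact_continuous_image[OF polys_continuous[OF assms(2)] compact_cbox] compact_imp_bounded by blast
  ultimately show ?thesis by (meson bounded_subset image_mono)
qed

lemma set_integrable_mult_polys:
  assumes "R \<in> rectangles" "g \<in> polys m" "set_integrable lebesgue R f"
  shows "set_integrable lebesgue R (\<lambda>x. f x * g x)"
proof -
  have "g \<in> borel_measurable (lebesgue_on R)"
    using assms(2) by (intro measurable_restrict_space1 measurable_completion) (simp add: polys_measurable)
  then have "set_integrable lebesgue R (\<lambda>x. g x * f x)"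
    by (rule absolutely_integrable_bounded_measurable_product[OF bilinear_times])
      (use assms in \<open>auto intro: rectangle_sets polys_bounded_on_rectangle\<close>)
  then show ?thesis by (simp add: mult.commute)
qed

lemma avg_diff:
  "set_integrable lebesgue R f \<Longrightarrow> set_integrable lebesgue R g \<Longrightarrow>
    avg R (\<lambda>x. f x - g x) = avg R f - avg R g"
  by (simp add: avg_def diff_divide_distrib)

lemma avg_cmult: "avg R (\<lambda>x. c * f x) = c * avg R f"
  by (simp add: avg_def)

lemma avg_sum:
  assumes "\<And>i. i \<in> A \<Longrightarrow> set_integrable lebesgue R (f i)"
  shows "avg R (\<lambda>x. \<Sum>i\<in>A. f i x) = (\<Sum>i\<in>A. avg R (f i))"
  using assms
  by (simp add: avg_def set_lebesgue_integral_def set_integrable_def sum_divide_distrib sum_distrib_left)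

lemma avg_mono:
  assumes "set_integrable lebesgue R f" "set_integrable lebesgue R g" "\<And>x. x \<in> R \<Longrightarrow> f x \<le> g x"
  shows "avg R f \<le> avg R g"
  unfolding avg_def by (intro divide_right_mono set_integral_mono assms) simp_all

lemma abs_avg_le: "\<bar>avg R f\<bar> \<le> avg R (\<lambda>x. \<bar>f x\<bar>)"
proof -
  have "\<bar>LINT x:R|lebesgue. f x\<bar> \<le> (LINT x:R|lebesgue. \<bar>f x\<bar>)"
    unfolding set_lebesgue_integral_def
    using integral_norm_bound[of lebesgue "\<lambda>x. indicator R x *\<^sub>R f x"] by (simp add: abs_mult)
  then show ?thesis by (simp add: avg_def abs_divide divide_right_mono)
qed

lemma avg_nonneg: "(\<And>x. 0 \<le> f x) \<Longrightarrow> 0 \<le> avg R f"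
  by (auto simp: avg_def set_lebesgue_integral_def intro!: divide_nonneg_nonneg Bochner_Integration.integral_nonneg)

text \<open>Definiteness of the inner product: \<open>g\<close> vanishes a.e. on the open box, its
  nonzero set there is open and negligible, hence empty, and a polynomial vanishing on a nonempty
  open set is zero.\<close>

lemma polys_avg_square_zero:
  assumes R: "R \<in> rectangles" and g: "g \<in> polys m" and z: "avg R (\<lambda>x. g x * g x) = 0"
  shows "g = (\<lambda>x. 0)"
proof -
  obtain l u where B: "box_bounds R l u" using rectangles_box_bounds[OF R] .
  have "set_integrable lebesgue R (\<lambda>x. g x * g x)"
    using set_integrable_mult_polys[OF R g set_integrable_polys[OF R g]] .
  moreover have "(LINT x:R|lebesgue. g x * g x) = 0"
    using z rectangles_measure(2)[OF R] by (simp add: avg_def)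
  ultimately have "AE x in lebesgue. indicator R x *\<^sub>R (g x * g x) = 0"
    unfolding set_lebesgue_integral_def set_integrable_def
    by (subst (asm) integral_nonneg_eq_0_iff_AE) (auto simp: indicator_def)
  then have "AE x in lebesgue. x \<notin> {x \<in> box l u. g x \<noteq> 0}"
    by eventually_elim (use box_boundsD(2)[OF B] in \<open>auto simp: indicator_def split: if_splits\<close>)
  then have "{x \<in> box l u. g x \<noteq> 0} \<in> null_sets lebesgue"
    by (auto simp: eventually_ae_filter intro: null_sets_completion_subset)
  moreover have "open {x \<in> box l u. g x \<noteq> 0}"
  proof -
    have "open (box l u \<inter> g -` (- {0}))"
      by (rule continuous_open_preimage[OF polys_continuous[OF g]]) auto
    then show ?thesis by (simp add: Int_def vimage_def)
  qed
  ultimately have e: "{x \<in> box l u. g x \<noteq> 0} = {}"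
    using open_not_negligible negligible_iff_null_sets by metis
  have "box l u \<noteq> {}" using box_boundsD(1)[OF B] by (auto simp: interval_eq_empty_cart not_le)
  then have "g x = 0" for x
    by (rule polys_eq_zero[OF g open_box]) (use e in blast)
  then show ?thesis by blast
qed

section \<open>Orthonormal bases of polynomials\<close>

text \<open>Leaves out the spanning clause of \<open>orthonormal_basis\<close>, so as to apply to
  the partial families of the Gram-Schmidt process.\<close>

definition orthonormal_on :: "(real ^ 'n) set \<Rightarrow> (real ^ 'n \<Rightarrow> real) set \<Rightarrow> bool" where
  "orthonormal_on R B \<longleftrightarrow> (\<forall>\<phi>\<in>B. \<forall>\<psi>\<in>B. avg R (\<lambda>x. \<phi> x * \<psi> x) = (if \<phi> = \<psi> then 1 else 0))"

lemma avg_lincomb_mult: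
  assumes "R \<in> rectangles" "B \<subseteq> polys m" "set_integrable lebesgue R f"
  shows "avg R (\<lambda>x. f x * (\<Sum>\<phi>\<in>B. c \<phi> * \<phi> x)) = (\<Sum>\<phi>\<in>B. c \<phi> * avg R (\<lambda>x. f x * \<phi> x))"
proof -
  have "avg R (\<lambda>x. f x * (\<Sum>\<phi>\<in>B. c \<phi> * \<phi> x)) = avg R (\<lambda>x. \<Sum>\<phi>\<in>B. c \<phi> * (f x * \<phi> x))"
    by (simp add: sum_distrib_left mult_ac)
  also have "\<dots> = (\<Sum>\<phi>\<in>B. avg R (\<lambda>x. c \<phi> * (f x * \<phi> x)))"
    using assms by (intro avg_sum set_integrable_mult_right) (auto intro: set_integrable_mult_polys)
  finally show ?thesis by (simp add: avg_cmult)
qed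

lemma avg_orthonormal_lincomb:
  assumes R: "R \<in> rectangles" and B: "finite B" "B \<subseteq> polys m" "orthonormal_on R B" and \<psi>: "\<psi> \<in> B"
  shows "avg R (\<lambda>x. \<psi> x * (\<Sum>\<phi>\<in>B. c \<phi> * \<phi> x)) = c \<psi>"
proof -
  have "avg R (\<lambda>x. \<psi> x * (\<Sum>\<phi>\<in>B. c \<phi> * \<phi> x)) = (\<Sum>\<phi>\<in>B. c \<phi> * avg R (\<lambda>x. \<psi> x * \<phi> x))"
    using B \<psi> by (intro avg_lincomb_mult[OF R B(2)] set_integrable_polys[OF R]) auto
  also have "\<dots> = (\<Sum>\<phi>\<in>B. if \<psi> = \<phi> then c \<phi> else 0)"
    using B(3) \<psi> by (intro sum.cong) (auto simp: orthonormal_on_def)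
  finally show ?thesis using B(1) \<psi> by simp
qed

lemma parseval:
  assumes R: "R \<in> rectangles" and B: "finite B" "B \<subseteq> polys m" "orthonormal_on R B"
    and g: "g = (\<lambda>x. \<Sum>\<phi>\<in>B. c \<phi> * \<phi> x)"
  shows "avg R (\<lambda>x. (g x)\<^sup>2) = (\<Sum>\<phi>\<in>B. (c \<phi>)\<^sup>2)"
proof -
  have gp: "g \<in> polys m" unfolding g using B(2) by (intro polys_sum polys_cmult) auto
  have "avg R (\<lambda>x. (g x)\<^sup>2) = avg R (\<lambda>x. g x * (\<Sum>\<phi>\<in>B. c \<phi> * \<phi> x))"
    by (simp add: g power2_eq_square)
  also have "\<dots> = (\<Sum>\<phi>\<in>B. c \<phi> * avg R (\<lambda>x. g x * \<phi> x))"
    by (rule avg_lincomb_mult[OF R B(2) set_integrable_polys[OF R gp]])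
  also have "\<dots> = (\<Sum>\<phi>\<in>B. (c \<phi>)\<^sup>2)"
  proof (rule sum.cong)
    fix \<phi> assume "\<phi> \<in> B"
    from avg_orthonormal_lincomb[OF R B this, of c]
    have "avg R (\<lambda>x. g x * \<phi> x) = c \<phi>" by (simp add: g mult.commute)
    then show "c \<phi> * avg R (\<lambda>x. g x * \<phi> x) = (c \<phi>)\<^sup>2" by (simp add: power2_eq_square)
  qed simp
  finally show ?thesis .
qed

text \<open>Induction on \<open>F\<close>, which may be linearly dependent: a vector whose residual
  has norm zero is already in the span.\<close>

lemma gram_schmidt:
  assumes R: "R \<in> rectangles" and "finite F" "F \<subseteq> polys m"
  shows "\<exists>B. finite B \<and> B \<subseteq> polys m \<and> orthonormal_on R B \<and>
    (\<forall>g\<in>F. \<exists>c. g = (\<lambda>x. \<Sum>\<phi>\<in>B. c \<phi> * \<phi> x))"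
  using assms(2,3)
proof induction
  case empty
  then show ?case by (intro exI[of _ "{}"]) (simp add: orthonormal_on_def)
next
  case (insert v F)
  then obtain B where B: "finite B" "B \<subseteq> polys m" "orthonormal_on R B"
    and span: "\<And>g. g \<in> F \<Longrightarrow> \<exists>c. g = (\<lambda>x. \<Sum>\<phi>\<in>B. c \<phi> * \<phi> x)" by auto
  have v: "v \<in> polys m" using insert.prems by simp
  define d where "d \<phi> = avg R (\<lambda>x. \<phi> x * v x)" for \<phi>
  \<comment> \<open>The residual of \<open>v\<close> after subtracting its orthogonal projection
    onto the span of \<open>B\<close>.\<close>
  define v' where "v' = (\<lambda>x. v x - (\<Sum>\<phi>\<in>B. d \<phi> * \<phi> x))"
  have sp: "(\<lambda>x. \<Sum>\<phi>\<in>B. d \<phi> * \<phi> x) \<in> polys m" using B(2) by (intro polys_sum polys_cmult) auto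
  have v': "v' \<in> polys m" unfolding v'_def by (intro polys_diff v sp)
  have orth: "avg R (\<lambda>x. \<phi> x * v' x) = 0" if "\<phi> \<in> B" for \<phi>
  proof -
    have \<phi>: "set_integrable lebesgue R \<phi>" using that B(2) by (auto intro: set_integrable_polys[OF R])
    have "avg R (\<lambda>x. \<phi> x * v' x) = avg R (\<lambda>x. \<phi> x * v x) - avg R (\<lambda>x. \<phi> x * (\<Sum>\<phi>\<in>B. d \<phi> * \<phi> x))"
      unfolding v'_def right_diff_distrib
      by (intro avg_diff set_integrable_mult_polys[OF R v \<phi>] set_integrable_mult_polys[OF R sp \<phi>])
    also have "\<dots> = 0" by (simp add: avg_orthonormal_lincomb[OF R B that] d_def)
    finally show ?thesis .
  qed
  show ?case
  proof (cases "avg R (\<lambda>x. v' x * v' x) = 0")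
    case True
    then have "v' = (\<lambda>x. 0)" by (rule polys_avg_square_zero[OF R v'])
    then have "v = (\<lambda>x. \<Sum>\<phi>\<in>B. d \<phi> * \<phi> x)" by (simp add: v'_def fun_eq_iff)
    then show ?thesis using B span by (intro exI[of _ B]) auto
  next
    case False
    define N where "N = sqrt (avg R (\<lambda>x. v' x * v' x))"
    have pos: "avg R (\<lambda>x. v' x * v' x) > 0" using False avg_nonneg[of "\<lambda>x. v' x * v' x" R] by simp
    then have N: "N > 0" "N * N = avg R (\<lambda>x. v' x * v' x)" by (auto simp: N_def)
    define \<psi> where "\<psi> = (\<lambda>x. (1 / N) * v' x)"
    have \<psi>: "\<psi> \<in> polys m" unfolding \<psi>_def by (rule polys_cmult[OF v'])
    have o1: "avg R (\<lambda>x. \<phi> x * \<psi> x) = 0" if "\<phi> \<in> B" for \<phi>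
      using orth[OF that] avg_cmult[of R "1/N" "\<lambda>x. \<phi> x * v' x"] by (simp add: \<psi>_def mult_ac)
    then have o2: "avg R (\<lambda>x. \<psi> x * \<phi> x) = 0" if "\<phi> \<in> B" for \<phi>
      using that by (simp add: mult.commute)
    have o3: "avg R (\<lambda>x. \<psi> x * \<psi> x) = 1"
      using avg_cmult[of R "1/(N*N)" "\<lambda>x. v' x * v' x"] N pos by (simp add: \<psi>_def mult_ac)
    \<comment> \<open>A member of \<open>B\<close> is orthogonal to \<open>\<psi>\<close>, while
      \<open>\<psi>\<close> has norm 1.\<close>
    have nin: "\<psi> \<notin> B" using o1 o3 by fastforce
    have on: "orthonormal_on R (insert \<psi> B)"
      using B(3) o1 o2 o3 nin by (auto simp: orthonormal_on_def)
    have "\<exists>c. g = (\<lambda>x. \<Sum>\<phi>\<in>insert \<psi> B. c \<phi> * \<phi> x)" if g: "g \<in> insert v F" for g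
    proof -
      have ext: "(\<lambda>x. \<Sum>\<phi>\<in>insert \<psi> B. (c(\<psi> := t)) \<phi> * \<phi> x) = (\<lambda>x. t * \<psi> x + (\<Sum>\<phi>\<in>B. c \<phi> * \<phi> x))" for c t
        using nin B(1) by (intro HOL.ext, subst sum.insert) (auto intro!: sum.cong)
      consider "g = v" | "g \<in> F" using g by blast
      then show ?thesis
      proof cases
        case 1
        show ?thesis
        proof (rule exI)
          \<comment> \<open>\<open>v\<close> is its projection plus the residual, and the residual
            is \<open>N\<close> times \<open>\<psi>\<close>.\<close>
          show "g = (\<lambda>x. \<Sum>\<phi>\<in>insert \<psi> B. (d(\<psi> := N)) \<phi> * \<phi> x)"
            unfolding ext using 1 N by (simp add: \<psi>_def v'_def)
        qed
      next
        case 2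
        then obtain c where c: "g = (\<lambda>x. \<Sum>\<phi>\<in>B. c \<phi> * \<phi> x)" using span by blast
        show ?thesis
        proof (rule exI)
          show "g = (\<lambda>x. \<Sum>\<phi>\<in>insert \<psi> B. (c(\<psi> := 0)) \<phi> * \<phi> x)"
            unfolding ext by (simp add: c)
        qed
      qed
    qed
    then show ?thesis using B on \<psi> by (intro exI[of _ "insert \<psi> B"]) auto
  qed
qed

text \<open>Gram-Schmidt applied to the finitely many monomials. It guarantees that the
  \<open>SOME\<close> in \<open>poly_proj\<close> selects a genuine basis.\<close>

lemma orthonormal_basis_exists:
  assumes R: "R \<in> rectangles"
  shows "\<exists>B. orthonormal_basis m R B"
proof -
  let ?K = "{k :: 'a \<Rightarrow> nat. sum k UNIV \<le> m}"
  have "finite (monomial ` ?K)" "monomial ` ?K \<subseteq> polys m"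
    using finite_exponents by (auto intro: polys_monomial)
  from gram_schmidt[OF R this] obtain B where B: "finite B" "B \<subseteq> polys m" "orthonormal_on R B"
    and span: "\<forall>g\<in>monomial ` ?K. \<exists>c. g = (\<lambda>x. \<Sum>\<phi>\<in>B. c \<phi> * \<phi> x)"
    by (elim exE conjE) (rule that)
  define d where "d k = (SOME c. monomial k = (\<lambda>x. \<Sum>\<phi>\<in>B. c \<phi> * \<phi> x))" for k
  have d: "monomial k = (\<lambda>x. \<Sum>\<phi>\<in>B. d k \<phi> * \<phi> x)" if "k \<in> ?K" for k
    unfolding d_def by (rule someI_ex[OF bspec[OF span imageI[OF that]]])
  have "\<exists>c. g = (\<lambda>x. \<Sum>\<phi>\<in>B. c \<phi> * \<phi> x)" if g: "g \<in> polys m" for g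
  proof -
    obtain b where b: "g = (\<lambda>x. \<Sum>k\<in>?K. b k * monomial k x)" using g by (rule polysE)
    have "g x = (\<Sum>\<phi>\<in>B. (\<Sum>k\<in>?K. b k * d k \<phi>) * \<phi> x)" for x
    proof -
      have "g x = (\<Sum>k\<in>?K. b k * (\<Sum>\<phi>\<in>B. d k \<phi> * \<phi> x))"
        unfolding b by (intro sum.cong refl arg_cong2[of _ _ _ _ "(*)"] fun_cong[OF d])
      also have "\<dots> = (\<Sum>k\<in>?K. \<Sum>\<phi>\<in>B. b k * d k \<phi> * \<phi> x)"
        by (simp add: sum_distrib_left mult.assoc)
      also have "\<dots> = (\<Sum>\<phi>\<in>B. \<Sum>k\<in>?K. b k * d k \<phi> * \<phi> x)" by (rule sum.swap)
      finally show ?thesis by (simp add: sum_distrib_right)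
    qed
    then show ?thesis by (intro exI ext)
  qed
  then show ?thesis using B unfolding orthonormal_basis_def orthonormal_on_def by blast
qed

section \<open>Bounds uniform in the rectangle\<close>

text \<open>The Jacobian of the map from the unit cube to the rectangle cancels against the measure
  in the average. Continuity makes \<open>h\<close> integrable, and the faces of \<open>R\<close>
  contribute nothing.\<close>

lemma avg_affine:
  fixes h :: "real ^ 'n \<Rightarrow> real"
  assumes B: "box_bounds R l u" and h: "continuous_on UNIV h"
  shows "avg R h = avg (cbox 0 1) (\<lambda>x. h (\<chi> i. l $ i + (u $ i - l $ i) * x $ i))"
proof -
  have lu: "\<And>i. l $ i < u $ i" using box_boundsD(1)[OF B] .
  let ?c = "\<lambda>i. u $ i - l $ i" and ?A = "\<lambda>x. \<chi> i. l $ i + (u $ i - l $ i) * x $ i"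
  have ch: "continuous_on S h" for S using h continuous_on_subset by blast
  have neg: "negligible (cbox l u - R)" "negligible (R - cbox l u)"
    using box_bounds_measure(3)[OF B] by (auto simp: negligible_iff_null_sets[symmetric] negligible_Un_eq)
  have ih: "set_integrable lebesgue (cbox l u) h" by (rule absolutely_integrable_continuous[OF ch])
  have "R \<in> sets lebesgue" using box_bounds_measure(1)[OF B] by blast
  then have iR: "set_integrable lebesgue R h" by (rule set_integrable_subset[OF ih _ box_boundsD(3)[OF B]])
  have "(LINT x:R|lebesgue. h x) = integral R h" by (rule set_lebesgue_integral_eq_integral(2)[OF iR])
  also have "\<dots> = integral (cbox l u) h"
    using neg by (intro integral_spike_set) (auto intro: negligible_subset)
  finally have 1: "(LINT x:R|lebesgue. h x) = integral (cbox l u) h" .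
  have "(h has_integral integral (cbox l u) h) (cbox l u)"
    using integrable_integral[OF integrable_continuous[OF ch]] .
  \<comment> \<open>The lower corner is moved to the origin; then each side is rescaled to length
    1.\<close>
  from has_integral_affinity[OF this, of 1 l]
  have "((\<lambda>x. h (x + l)) has_integral integral (cbox l u) h) (cbox 0 (u - l))"
    using cbox_translation[of "- l" l u] by (simp add: add.commute[of _ "- l"])
  from has_integral_stretch_cart[OF this, of ?c]
  have "((\<lambda>x. h ((\<chi> k. ?c k * x $ k) + l)) has_integral integral (cbox l u) h /\<^sub>R \<bar>prod ?c UNIV\<bar>)
     ((\<lambda>x. \<chi> k. x $ k / ?c k) ` cbox 0 (u - l))"
    using lu by (simp add: less_imp_neq[symmetric])
  moreover have "(\<lambda>x. h ((\<chi> k. ?c k * x $ k) + l)) = (\<lambda>x. h (?A x))"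
    by (intro ext arg_cong[of _ _ h]) (simp add: vec_eq_iff add.commute)
  moreover have "(\<lambda>x. \<chi> k. x $ k / ?c k) ` cbox 0 (u - l) = cbox 0 1"
  proof (intro equalityI subsetI)
    fix y assume "y \<in> (\<lambda>x. \<chi> k. x $ k / ?c k) ` cbox 0 (u - l)"
    then show "y \<in> cbox 0 1" using lu by (auto simp: mem_box_cart intro!: divide_nonneg_pos)
  next
    fix y :: "real ^ 'n" assume y: "y \<in> cbox 0 1"
    have "y = (\<chi> k. (\<chi> k. ?c k * y $ k) $ k / ?c k)"
      using lu by (simp add: vec_eq_iff less_imp_neq[symmetric])
    moreover have "(\<chi> k. ?c k * y $ k) \<in> cbox 0 (u - l)"
      using y lu by (auto simp: mem_box_cart less_imp_le intro!: mult_left_le)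
    ultimately show "y \<in> (\<lambda>x. \<chi> k. x $ k / ?c k) ` cbox 0 (u - l)" by blast
  qed
  ultimately have 2: "integral (cbox 0 1) (\<lambda>x. h (?A x)) = integral (cbox l u) h / (\<Prod>i\<in>UNIV. ?c i)"
    using lu by (simp add: integral_unique prod_pos less_imp_le abs_of_pos divide_inverse mult.commute)
  have "continuous_on (cbox 0 1) (\<lambda>x. h (?A x))"
    by (intro continuous_on_compose2[OF h] continuous_intros) auto
  then have 3: "(LINT x:cbox 0 1|lebesgue. h (?A x)) = integral (cbox 0 1) (\<lambda>x. h (?A x))"
    by (intro set_lebesgue_integral_eq_integral(2) absolutely_integrable_continuous)
  have bb: "box_bounds (cbox 0 1 :: (real^'n) set) 0 1"
    by (simp add: box_bounds_def box_subset_cbox)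
  then have "measure lebesgue (cbox 0 1 :: (real^'n) set) = 1" by (simp add: box_bounds_measure(2)[OF bb])
  then show ?thesis
    unfolding avg_def by (simp add: 1 2 3 box_bounds_measure(2)[OF B])
qed

lemma unit_cube_rectangle: "cbox 0 1 \<in> (rectangles :: (real ^ 'n) set set)"
  unfolding rectangles_def
  by (intro CollectI exI[of _ "\<lambda>_. {0..1}"]) (auto simp: is_interval_cc mem_box_cart)

text \<open>On the unit cube, Cauchy-Schwarz in an orthonormal basis and \<open>parseval\<close>
  give the estimate, with \<open>C\<close> bounding the sum of the squares of the basis. Affine
  changes of variables preserve \<open>polys m\<close> and averages, so the same \<open>C\<close>
  serves every rectangle.\<close>

lemma polys_sup_bound:
  obtains C where "C > 0" "\<And>(R :: (real ^ 'n) set) g x. R \<in> rectangles \<Longrightarrow> g \<in> polys m \<Longrightarrow> x \<in> R \<Longrightarrow>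
     (g x)\<^sup>2 \<le> C * avg R (\<lambda>x. (g x)\<^sup>2)"
proof -
  let ?Q = "cbox 0 1 :: (real ^ 'n) set"
  obtain B where "orthonormal_basis m ?Q B" using orthonormal_basis_exists[OF unit_cube_rectangle] by blast
  then have B: "finite B" "B \<subseteq> polys m" "orthonormal_on ?Q B"
    and span: "\<And>g. g \<in> polys m \<Longrightarrow> \<exists>c. g = (\<lambda>x. \<Sum>\<phi>\<in>B. c \<phi> * \<phi> x)"
    by (auto simp: orthonormal_basis_def orthonormal_on_def)
  have "continuous_on ?Q (\<lambda>x. \<Sum>\<phi>\<in>B. (\<phi> x)\<^sup>2)"
    using B(2) by (intro continuous_intros) (auto intro: polys_continuous)
  then have "bounded ((\<lambda>x. \<Sum>\<phi>\<in>B. (\<phi> x)\<^sup>2) ` ?Q)"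
    by (intro compact_imp_bounded compact_continuous_image) auto
  then obtain C where C: "C > 0" "\<And>x. x \<in> ?Q \<Longrightarrow> (\<Sum>\<phi>\<in>B. (\<phi> x)\<^sup>2) \<le> C"
    unfolding bounded_pos by (auto simp: abs_le_iff)
  have cube: "(g x)\<^sup>2 \<le> C * avg ?Q (\<lambda>x. (g x)\<^sup>2)" if g: "g \<in> polys m" and x: "x \<in> ?Q" for g x
  proof -
    obtain c where c: "g = (\<lambda>x. \<Sum>\<phi>\<in>B. c \<phi> * \<phi> x)" using span[OF g] by blast
    have "(g x)\<^sup>2 \<le> (\<Sum>\<phi>\<in>B. (c \<phi>)\<^sup>2) * (\<Sum>\<phi>\<in>B. (\<phi> x)\<^sup>2)"
      unfolding c by (rule Cauchy_Schwarz_ineq_sum)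
    also have "\<dots> \<le> (\<Sum>\<phi>\<in>B. (c \<phi>)\<^sup>2) * C"
      using C(2)[OF x] by (intro mult_left_mono sum_nonneg) auto
    finally show ?thesis using parseval[OF unit_cube_rectangle B c] by (simp add: mult.commute)
  qed
  have "(g x)\<^sup>2 \<le> C * avg R (\<lambda>x. (g x)\<^sup>2)" if R: "R \<in> rectangles" and g: "g \<in> polys m" and x: "x \<in> R" for R :: "(real ^ 'n) set" and g x
  proof -
    obtain l u where bb: "box_bounds R l u" using rectangles_box_bounds[OF R] .
    have lu: "\<And>i. l $ i < u $ i" using box_boundsD(1)[OF bb] .
    define y where "y = (\<chi> i. (x $ i - l $ i) / (u $ i - l $ i))"
    have "x \<in> cbox l u" using x box_boundsD(3)[OF bb] by blast
    then have y: "y \<in> ?Q" using lu by (auto simp: mem_box_cart y_def divide_le_eq intro!: divide_nonneg_pos)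
    have Ay: "(\<chi> i. l $ i + (u $ i - l $ i) * y $ i) = x"
      using lu by (simp add: vec_eq_iff y_def less_imp_neq[symmetric])
    have "continuous_on UNIV (\<lambda>x. (g x)\<^sup>2)" using polys_continuous[OF g] by (intro continuous_intros)
    from avg_affine[OF bb this] cube[OF polys_compose_affine[OF g] y, of "\<lambda>i. l $ i" "\<lambda>i. u $ i - l $ i"]
    show ?thesis by (simp add: Ay)
  qed
  then show ?thesis using that C(1) by blast
qed

lemma poly_proj_basis:
  assumes R: "R \<in> rectangles"
  obtains B where "finite B" "B \<subseteq> polys m" "orthonormal_on R B"
    "\<And>g. g \<in> polys m \<Longrightarrow> \<exists>c. g = (\<lambda>x. \<Sum>\<phi>\<in>B. c \<phi> * \<phi> x)"
    "\<And>f. poly_proj m R f = (\<lambda>x. \<Sum>\<phi>\<in>B. avg R (\<lambda>y. f y * \<phi> y) * \<phi> x)"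
proof -
  define B where "B = (SOME B. orthonormal_basis m R B)"
  have "orthonormal_basis m R B"
    unfolding B_def using orthonormal_basis_exists[OF R] by (rule someI_ex)
  moreover have "poly_proj m R f = (\<lambda>x. \<Sum>\<phi>\<in>B. avg R (\<lambda>y. f y * \<phi> y) * \<phi> x)" for f
    by (simp add: poly_proj_def B_def Let_def)
  ultimately show ?thesis
    using that[of B] unfolding orthonormal_basis_def orthonormal_on_def by blast
qed

lemma poly_proj_polys:
  assumes R: "R \<in> rectangles" shows "poly_proj m R f \<in> polys m"
proof -
  obtain B where "B \<subseteq> polys m" "poly_proj m R f = (\<lambda>x. \<Sum>\<phi>\<in>B. avg R (\<lambda>y. f y * \<phi> y) * \<phi> x)"
    by (rule poly_proj_basis[OF R, of m]) (rule that, assumption+)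
  then show ?thesis by (auto intro!: polys_sum polys_cmult)
qed

lemma poly_proj_id:
  assumes R: "R \<in> rectangles" and g: "g \<in> polys m" shows "poly_proj m R g = g"
proof -
  obtain B where B: "finite B" "B \<subseteq> polys m" "orthonormal_on R B"
    and span: "\<And>g. g \<in> polys m \<Longrightarrow> \<exists>c. g = (\<lambda>x. \<Sum>\<phi>\<in>B. c \<phi> * \<phi> x)"
    and P: "\<And>f. poly_proj m R f = (\<lambda>x. \<Sum>\<phi>\<in>B. avg R (\<lambda>y. f y * \<phi> y) * \<phi> x)"
    by (rule poly_proj_basis[OF R, of m]) (rule that, assumption+)
  obtain c where c: "g = (\<lambda>x. \<Sum>\<phi>\<in>B. c \<phi> * \<phi> x)" using span[OF g] by blast
  have "avg R (\<lambda>y. g y * \<phi> y) = c \<phi>" if "\<phi> \<in> B" for \<phi>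
    using avg_orthonormal_lincomb[OF R B that, of c] by (simp add: c mult.commute)
  then have "poly_proj m R g = (\<lambda>x. \<Sum>\<phi>\<in>B. c \<phi> * \<phi> x)" unfolding P by simp
  then show ?thesis by (simp add: c)
qed

lemma poly_proj_diff:
  assumes R: "R \<in> rectangles" and f: "set_integrable lebesgue R f" and g: "set_integrable lebesgue R g"
  shows "poly_proj m R (\<lambda>x. f x - g x) x = poly_proj m R f x - poly_proj m R g x"
proof -
  obtain B where B: "B \<subseteq> polys m"
    and P: "\<And>f. poly_proj m R f = (\<lambda>x. \<Sum>\<phi>\<in>B. avg R (\<lambda>y. f y * \<phi> y) * \<phi> x)"
    by (rule poly_proj_basis[OF R, of m]) (rule that, assumption+)
  have "avg R (\<lambda>y. (f y - g y) * \<phi> y) = avg R (\<lambda>y. f y * \<phi> y) - avg R (\<lambda>y. g y * \<phi> y)" if "\<phi> \<in> B" for \<phi>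
    unfolding left_diff_distrib using that B
    by (intro avg_diff set_integrable_mult_polys[OF R _ f] set_integrable_mult_polys[OF R _ g]) auto
  then show ?thesis unfolding P by (simp add: left_diff_distrib sum_subtractf)
qed

text \<open>The projection is integration against a reproducing kernel. Cauchy-Schwarz bounds the
  kernel by its diagonal, and \<open>polys_sup_bound\<close> bounds the diagonal uniformly in the
  rectangle.\<close>

lemma poly_proj_bound:
  obtains C where "C > 0"
    "\<And>(R :: (real ^ 'n) set) f x. R \<in> rectangles \<Longrightarrow> set_integrable lebesgue R f \<Longrightarrow> x \<in> R \<Longrightarrow>
     \<bar>poly_proj m R f x\<bar> \<le> C * avg R (\<lambda>x. \<bar>f x\<bar>)"
proof -
  obtain C where C: "C > 0" and bound: "\<And>(R :: (real ^ 'n) set) g x. R \<in> rectangles \<Longrightarrow> g \<in> polys m \<Longrightarrow> x \<in> R \<Longrightarrow>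
     (g x)\<^sup>2 \<le> C * avg R (\<lambda>x. (g x)\<^sup>2)" using polys_sup_bound by blast
  have "\<bar>poly_proj m R f x\<bar> \<le> C * avg R (\<lambda>x. \<bar>f x\<bar>)"
    if R: "R \<in> rectangles" and f: "set_integrable lebesgue R f" and x: "x \<in> R" for R :: "(real ^ 'n) set" and f x
  proof -
    obtain B where B: "finite B" "B \<subseteq> polys m" "orthonormal_on R B"
      and P: "\<And>f. poly_proj m R f = (\<lambda>x. \<Sum>\<phi>\<in>B. avg R (\<lambda>y. f y * \<phi> y) * \<phi> x)"
      by (rule poly_proj_basis[OF R, of m]) (rule that, assumption+)
    \<comment> \<open>the reproducing kernel: the sup bound for \<open>?K z\<close> at \<open>z\<close> reads \<open>(?K z z)\<^sup>2 \<le> C * ?K z z\<close>\<close>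
    let ?K = "\<lambda>z y. \<Sum>\<phi>\<in>B. \<phi> z * \<phi> y"
    have Kp: "?K z \<in> polys m" for z using B(2) by (intro polys_sum polys_cmult) auto
    have diag: "(\<Sum>\<phi>\<in>B. (\<phi> z)\<^sup>2) \<le> C" if "z \<in> R" for z
    proof -
      have "(?K z z)\<^sup>2 \<le> C * avg R (\<lambda>y. (?K z y)\<^sup>2)" by (rule bound[OF R Kp that])
      also have "avg R (\<lambda>y. (?K z y)\<^sup>2) = (\<Sum>\<phi>\<in>B. (\<phi> z)\<^sup>2)" by (rule parseval[OF R B refl])
      finally have "(\<Sum>\<phi>\<in>B. (\<phi> z)\<^sup>2) * (\<Sum>\<phi>\<in>B. (\<phi> z)\<^sup>2) \<le> C * (\<Sum>\<phi>\<in>B. (\<phi> z)\<^sup>2)"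
        by (simp add: power2_eq_square)
      moreover have "(\<Sum>\<phi>\<in>B. (\<phi> z)\<^sup>2) \<ge> 0" by (intro sum_nonneg) auto
      \<comment> \<open>Division by the diagonal value; if that is zero, the bound is
        trivial.\<close>
      ultimately show ?thesis using C by (cases "(\<Sum>\<phi>\<in>B. (\<phi> z)\<^sup>2) = 0") auto
    qed
    have K: "\<bar>?K x y\<bar> \<le> C" if "y \<in> R" for y
    proof (rule power2_le_imp_le)
      have "(?K x y)\<^sup>2 \<le> (\<Sum>\<phi>\<in>B. (\<phi> x)\<^sup>2) * (\<Sum>\<phi>\<in>B. (\<phi> y)\<^sup>2)" by (rule Cauchy_Schwarz_ineq_sum)
      also have "\<dots> \<le> C * C" using diag[OF x] diag[OF that] C by (intro mult_mono sum_nonneg) auto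
      finally show "\<bar>?K x y\<bar>\<^sup>2 \<le> C\<^sup>2" by (simp add: power2_eq_square)
    qed (use C in simp)
    have fK: "set_integrable lebesgue R (\<lambda>y. f y * ?K x y)" by (rule set_integrable_mult_polys[OF R Kp f])
    have "poly_proj m R f x = (\<Sum>\<phi>\<in>B. \<phi> x * avg R (\<lambda>y. f y * \<phi> y))"
      unfolding P by (simp add: mult.commute)
    also have "\<dots> = avg R (\<lambda>y. f y * ?K x y)" by (rule avg_lincomb_mult[OF R B(2) f, symmetric])
    finally have eq: "poly_proj m R f x = avg R (\<lambda>y. f y * ?K x y)" .
    have "\<bar>poly_proj m R f x\<bar> \<le> avg R (\<lambda>y. \<bar>f y * ?K x y\<bar>)"
      unfolding eq by (rule abs_avg_le)
    also have "\<dots> \<le> avg R (\<lambda>y. C * \<bar>f y\<bar>)"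
    proof (rule avg_mono)
      show "\<bar>f y * ?K x y\<bar> \<le> C * \<bar>f y\<bar>" if "y \<in> R" for y
        using mult_left_mono[OF K[OF that], of "\<bar>f y\<bar>"] by (simp add: abs_mult mult.commute)
    qed (auto intro!: set_integrable_abs fK f)
    finally show ?thesis by (simp add: avg_cmult)
  qed
  then show ?thesis using that C by blast
qed

text \<open>The projection on \<open>Q\<close> is linear and fixes polynomials, so the jump from one
  projection to another is itself the projection of an oscillation.\<close>

lemma poly_proj_subrect:
  assumes "R \<in> rectangles" "Q \<in> rectangles" and f: "set_integrable lebesgue Q f"
  shows "poly_proj m Q (\<lambda>x. f x - poly_proj m R f x) x = poly_proj m Q f x - poly_proj m R f x"
  using poly_proj_diff[OF assms(2) f set_integrable_polys[OF assms(2) poly_proj_polys[OF assms(1)]], of m m f x]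
    poly_proj_id[OF assms(2) poly_proj_polys[OF assms(1)]]
  by simp

section \<open>The Calderon-Zygmund decomposition\<close>

text \<open>Countable additivity on both sides; values in \<open>ennreal\<close> avoid any question
  of summability.\<close>

lemma emeasure_UN_le:
  assumes "countable I" and "\<And>i. i \<in> I \<Longrightarrow> X i \<in> sets M" "\<And>i. i \<in> I \<Longrightarrow> Y i \<in> sets N"
    and "disjoint_family_on X I" "disjoint_family_on Y I"
    and "\<And>i. i \<in> I \<Longrightarrow> emeasure M (X i) \<le> emeasure N (Y i)"
  shows "emeasure M (\<Union>i\<in>I. X i) \<le> emeasure N (\<Union>i\<in>I. Y i)"
proof -
  have "emeasure M (\<Union>i\<in>I. X i) = (\<integral>\<^sup>+i. emeasure M (X i) \<partial>count_space I)"
    by (rule emeasure_UN_countable[OF assms(2,1,4)])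
  also have "\<dots> \<le> (\<integral>\<^sup>+i. emeasure N (Y i) \<partial>count_space I)"
    by (rule nn_integral_mono) (use assms(6) in simp)
  also have "\<dots> = emeasure N (\<Union>i\<in>I. Y i)"
    by (rule emeasure_UN_countable[OF assms(3,1,5), symmetric])
  finally show ?thesis .
qed

lemma disjoint_family_on_id: "disjoint D \<Longrightarrow> disjoint_family_on (\<lambda>Q. Q) D"
  by (auto simp: disjoint_def disjoint_family_on_def)

lemma dyadic_Union_sets:
  assumes "R \<in> rectangles" "D \<subseteq> dyadic_subrects R"
  shows "\<Union>D \<in> sets lebesgue" "\<Union>D \<in> lmeasurable" "\<Union>D \<subseteq> R" "countable D"
    "\<And>Q. Q \<in> D \<Longrightarrow> Q \<in> rectangles"
proof -
  show c: "countable D" using assms(2) countable_dyadic_subrects countable_subset by blast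
  show r: "Q \<in> rectangles" if "Q \<in> D" for Q using that assms dyadic_subrects_rectangle by blast
  show s: "\<Union>D \<in> sets lebesgue" using c r by (intro sets.countable_Union) (auto intro: rectangle_sets)
  show sub: "\<Union>D \<subseteq> R" using assms(2) dyadic_subrects_subset by blast
  show "\<Union>D \<in> lmeasurable"
    using fmeasurableI2[OF rectangles_measure(1)[OF assms(1)] sub s] .
qed

text \<open>\<open>h\<close> is controlled only on \<open>R\<close>; the factor
  \<open>indicator R\<close> makes the density measurable on the whole space.\<close>

lemma emeasure_density_abs:
  assumes h: "set_integrable lebesgue R h" and R: "R \<in> sets lebesgue" and Q: "Q \<in> sets lebesgue" "Q \<subseteq> R"
  shows "emeasure (density lebesgue (\<lambda>x. ennreal (indicator R x * \<bar>h x\<bar>))) Q = ennreal (LINT x:Q|lebesgue. \<bar>h x\<bar>)"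
proof -
  have int: "integrable lebesgue (\<lambda>x. indicator R x * \<bar>h x\<bar>)"
    using set_integrable_abs[OF h] by (simp add: set_integrable_def)
  have intQ: "set_integrable lebesgue Q (\<lambda>x. \<bar>h x\<bar>)"
    using set_integrable_subset[OF set_integrable_abs[OF h] Q] .
  have "emeasure (density lebesgue (\<lambda>x. ennreal (indicator R x * \<bar>h x\<bar>))) Q =
      (\<integral>\<^sup>+x. ennreal (indicator R x * \<bar>h x\<bar>) * indicator Q x \<partial>lebesgue)"
    using int Q by (intro emeasure_density) auto
  also have "\<dots> = (\<integral>\<^sup>+x. ennreal (indicator Q x *\<^sub>R \<bar>h x\<bar>) \<partial>lebesgue)"
    using Q(2) by (intro nn_integral_cong) (auto simp: indicator_def)
  also have "\<dots> = ennreal (LINT x:Q|lebesgue. \<bar>h x\<bar>)"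
    unfolding set_lebesgue_integral_def
    using intQ by (intro nn_integral_eq_integral) (auto simp: set_integrable_def)
  finally show ?thesis .
qed

lemma emeasure_density_const_lebesgue:
  assumes "A \<in> lmeasurable" "0 \<le> t"
  shows "emeasure (density lebesgue (\<lambda>_. ennreal t)) A = ennreal (t * measure lebesgue A)"
proof -
  have "emeasure (density lebesgue (\<lambda>_. ennreal t)) A = ennreal t * emeasure lebesgue A"
    using assms(1) by (subst emeasure_density) (auto simp: nn_integral_cmult fmeasurableD)
  then show ?thesis using assms by (simp add: emeasure_eq_measure2 ennreal_mult)
qed

text \<open>The a.e. bound off the selected rectangles is obtained without differentiation theory:
  a set on which all dyadic averages are at most \<open>t\<close> is covered, up to small excess measure, by
  disjoint dyadic rectangles with such averages.\<close>
lemma calderon_zygmund: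
  fixes R :: "(real ^ 'n) set"
  assumes R: "R \<in> rectangles" and h: "set_integrable lebesgue R h"
    and t: "0 < t" "avg R (\<lambda>x. \<bar>h x\<bar>) \<le> t"
  obtains D where "D \<subseteq> dyadic_subrects R" "disjoint D"
    "t * measure lebesgue (\<Union>D) \<le> (LINT x:R|lebesgue. \<bar>h x\<bar>)"
    "\<And>Q. Q \<in> D \<Longrightarrow> avg Q (\<lambda>x. \<bar>h x\<bar>) \<le> 2 ^ CARD('n) * t"
    "AE x in lebesgue. x \<in> R - \<Union>D \<longrightarrow> \<bar>h x\<bar> \<le> t"
proof -
  \<comment> \<open>On a dyadic subrectangle, comparing the average of |h| with \<open>t\<close>
    amounts to comparing the measures \<open>H\<close> and \<open>T\<close>.\<close>
  define H where "H = density lebesgue (\<lambda>x. ennreal (indicator R x * \<bar>h x\<bar>))"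
  define T where "T = density (lebesgue :: (real^'n) measure) (\<lambda>_. ennreal t)"
  have sHT [simp]: "sets H = sets lebesgue" "sets T = sets lebesgue" by (auto simp: H_def T_def)
  have emH: "emeasure H Q = ennreal (LINT x:Q|lebesgue. \<bar>h x\<bar>)" if "Q \<in> sets lebesgue" "Q \<subseteq> R" for Q
    unfolding H_def using emeasure_density_abs[OF h rectangle_sets[OF R] that] .
  have emT: "emeasure T Q = ennreal (t * measure lebesgue Q)" if "Q \<in> lmeasurable" for Q
    unfolding T_def using emeasure_density_const_lebesgue[OF that] t by simp
  have int_nonneg: "0 \<le> (LINT x:Q|lebesgue. \<bar>h x\<bar>)" for Q
    by (auto simp: set_lebesgue_integral_def intro!: Bochner_Integration.integral_nonneg)
  have avg_eq: "(LINT x:Q|lebesgue. \<bar>h x\<bar>) = avg Q (\<lambda>x. \<bar>h x\<bar>) * measure lebesgue Q" if "Q \<in> rectangles" for Q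
    using rectangles_measure(2)[OF that] by (simp add: avg_def)
  have subR: "Q \<in> rectangles \<and> Q \<subseteq> R" if "Q \<in> dyadic_subrects R" for Q
    using that R dyadic_subrects_rectangle dyadic_subrects_subset by blast
  define P where "P Q \<longleftrightarrow> t < avg Q (\<lambda>x. \<bar>h x\<bar>)" for Q :: "(real ^ 'n) set"
  define D where "D = maximal_dyadic R P"
  have D: "D \<subseteq> dyadic_subrects R" "disjoint D"
    by (auto simp: D_def disjoint_maximal_dyadic intro: subsetD[OF maximal_dyadic_subrects])
  note UD = dyadic_Union_sets[OF R D(1)]
  have 1: "t * measure lebesgue (\<Union>D) \<le> (LINT x:R|lebesgue. \<bar>h x\<bar>)"
  proof -
    have "emeasure T (\<Union>Q\<in>D. Q) \<le> emeasure H (\<Union>Q\<in>D. Q)"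
    proof (rule emeasure_UN_le)
      fix Q assume Q: "Q \<in> D"
      then have r: "Q \<in> rectangles" "Q \<subseteq> R" using subR D(1) by auto
      have "t < avg Q (\<lambda>x. \<bar>h x\<bar>)" using maximal_dyadicD Q unfolding D_def P_def by blast
      then have "t * measure lebesgue Q \<le> (LINT x:Q|lebesgue. \<bar>h x\<bar>)"
        using avg_eq[OF r(1)] by (simp add: mult_right_mono)
      then show "emeasure T Q \<le> emeasure H Q"
        using r rectangles_measure(1)[OF r(1)] by (simp add: emT emH rectangle_sets ennreal_leI)
    qed (use D(2) UD in \<open>auto simp: rectangle_sets disjoint_family_on_id\<close>)
    also have "\<dots> \<le> emeasure H R"
      using rectangle_sets[OF R] UD(3) by (intro emeasure_mono) auto
    finally have "ennreal (t * measure lebesgue (\<Union>D)) \<le> ennreal (LINT x:R|lebesgue. \<bar>h x\<bar>)"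
      using emT[OF UD(2)] emH[OF rectangle_sets[OF R]] by simp
    then show ?thesis using int_nonneg by (simp add: ennreal_le_iff)
  qed
  have 2: "avg Q (\<lambda>x. \<bar>h x\<bar>) \<le> 2 ^ CARD('n) * t" if Q: "Q \<in> D" for Q
  proof -
    \<comment> \<open>The parent has average at most \<open>t\<close>, and passing to the child
      divides the measure by \<open>2 ^ CARD('n)\<close>, which costs that factor in the
      average.\<close>
    have "\<not> P R" using t(2) by (simp add: P_def)
    then obtain Q' S where Q': "Q' \<in> dyadic_subrects R" "\<not> P Q'" "Q = dyadic_child Q' S"
      using maximal_dyadic_parent Q unfolding D_def by blast
    have "Q \<subseteq> Q'" by (auto simp: Q'(3) dyadic_child_def)
    then have r: "Q \<in> rectangles" "Q' \<in> rectangles" "Q' \<subseteq> R" "Q \<subseteq> Q'"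
      using subR[of Q] subR[OF Q'(1)] Q D(1) by auto
    have "ennreal (LINT x:Q|lebesgue. \<bar>h x\<bar>) \<le> ennreal (LINT x:Q'|lebesgue. \<bar>h x\<bar>)"
      using emeasure_mono[of Q Q' H] r emH by (auto simp: rectangle_sets)
    then have "(LINT x:Q|lebesgue. \<bar>h x\<bar>) \<le> (LINT x:Q'|lebesgue. \<bar>h x\<bar>)"
      using int_nonneg by (simp add: ennreal_le_iff)
    also have "\<dots> \<le> t * measure lebesgue Q'"
      using avg_eq[OF r(2)] Q'(2) by (simp add: P_def mult_right_mono)
    also have "\<dots> = 2 ^ CARD('n) * t * measure lebesgue Q"
      using measure_dyadic_child[OF r(2), of S] by (simp add: Q'(3))
    finally show ?thesis
      using rectangles_measure(2)[OF r(1)] avg_eq[OF r(1)] by simp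
  qed
  \<comment> \<open>The exceptional set, to be shown null. At its points all averages in the dyadic
    chain are at most \<open>t\<close>.\<close>
  define A where "A = {x \<in> R - \<Union>D. t < \<bar>h x\<bar>}"
  have mh: "(\<lambda>x. indicator R x *\<^sub>R h x) \<in> borel_measurable lebesgue"
    using h by (simp add: set_integrable_def borel_measurable_integrable)
  have Ams: "A \<in> sets lebesgue"
  proof -
    have "A = (R - \<Union>D) \<inter> {x \<in> space lebesgue. t < \<bar>indicator R x *\<^sub>R h x\<bar>}"
      by (auto simp: A_def)
    moreover have "{x \<in> space lebesgue. t < \<bar>indicator R x *\<^sub>R h x\<bar>} \<in> sets lebesgue"
      using mh by measurable
    ultimately show ?thesis using UD(1) rectangle_sets[OF R] by auto
  qed
  have AR: "A \<subseteq> R" by (auto simp: A_def)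
  have Alm: "A \<in> lmeasurable" using fmeasurableI2[OF rectangles_measure(1)[OF R] AR Ams] .
  have intA: "set_integrable lebesgue A (\<lambda>x. \<bar>h x\<bar>)"
    using set_integrable_subset[OF set_integrable_abs[OF h] Ams AR] .
  have low: "avg (dyadic_at R j x) (\<lambda>x. \<bar>h x\<bar>) \<le> t" if "x \<in> A" for x j
    using that unfolding A_def D_def Union_maximal_dyadic P_def by (auto simp: not_less)
  have "(LINT x:A|lebesgue. \<bar>h x\<bar>) \<le> t * measure lebesgue A + t * e" if e: "e > 0" for e
  proof -
    obtain U where U: "open U" "A \<subseteq> U" "U - A \<in> lmeasurable" "emeasure lebesgue (U - A) < ennreal e"
      using sets_lebesgue_outer_open[OF Ams e] by blast
    have mUA: "measure lebesgue (U - A) \<le> e"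
      using U(3,4) e by (simp add: emeasure_eq_measure2 ennreal_less_iff)
    \<comment> \<open>Staying inside the open set \<open>U\<close> keeps the covering rectangles
      within measure \<open>e\<close> of \<open>A\<close>; far enough along the chain of a point of
      \<open>A\<close>, the rectangles do so.\<close>
    define P' where "P' Q \<longleftrightarrow> Q \<subseteq> U \<and> avg Q (\<lambda>x. \<bar>h x\<bar>) \<le> t" for Q
    define D' where "D' = maximal_dyadic R P'"
    have D': "D' \<subseteq> dyadic_subrects R" "disjoint D'"
      by (auto simp: D'_def disjoint_maximal_dyadic intro: subsetD[OF maximal_dyadic_subrects])
    note UD' = dyadic_Union_sets[OF R D'(1)]
    have P'D: "P' Q" if "Q \<in> D'" for Q using maximal_dyadicD that unfolding D'_def by blast
    have AD': "A \<subseteq> \<Union>D'"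
    proof
      fix x assume x: "x \<in> A"
      then obtain r where r: "r > 0" "ball x r \<subseteq> U" using U(1,2) open_contains_ball by blast
      obtain j where "dyadic_at R j x \<subseteq> ball x r" using dyadic_at_small[OF R _ r(1)] x AR by blast
      then have "P' (dyadic_at R j x)" using low[OF x] r by (auto simp: P'_def)
      then show "x \<in> \<Union>D'" unfolding D'_def Union_maximal_dyadic using x AR by blast
    qed
    have "emeasure H A \<le> emeasure H (\<Union>Q\<in>D'. Q)"
      using AD' UD'(1) by (intro emeasure_mono) auto
    also have "\<dots> \<le> emeasure T (\<Union>Q\<in>D'. Q)"
    proof (rule emeasure_UN_le)
      fix Q assume Q: "Q \<in> D'"
      then have r: "Q \<in> rectangles" "Q \<subseteq> R" using subR D'(1) by auto
      have "(LINT x:Q|lebesgue. \<bar>h x\<bar>) \<le> t * measure lebesgue Q"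
        using avg_eq[OF r(1)] P'D[OF Q] by (simp add: P'_def mult_right_mono)
      then show "emeasure H Q \<le> emeasure T Q"
        using r rectangles_measure(1)[OF r(1)] by (simp add: emT emH rectangle_sets ennreal_leI)
    qed (use D'(2) UD' in \<open>auto simp: rectangle_sets disjoint_family_on_id\<close>)
    finally have "ennreal (LINT x:A|lebesgue. \<bar>h x\<bar>) \<le> ennreal (t * measure lebesgue (\<Union>D'))"
      using emH[OF Ams AR] emT[OF UD'(2)] by simp
    then have "(LINT x:A|lebesgue. \<bar>h x\<bar>) \<le> t * measure lebesgue (\<Union>D')"
      using t by (simp add: ennreal_le_iff)
    also have "\<dots> \<le> t * (measure lebesgue A + e)"
    proof (rule mult_left_mono)
      have "\<Union>D' \<subseteq> A \<union> (U - A)" using P'D by (auto simp: P'_def)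
      then have "measure lebesgue (\<Union>D') \<le> measure lebesgue (A \<union> (U - A))"
        using UD'(1) fmeasurable.Un[OF Alm U(3)] by (intro measure_mono_fmeasurable)
      also have "\<dots> \<le> measure lebesgue A + measure lebesgue (U - A)"
        using Ams U(3) by (intro measure_Un_le) auto
      finally show "measure lebesgue (\<Union>D') \<le> measure lebesgue A + e" using mUA by simp
    qed (use t in simp)
    finally show ?thesis by (simp add: distrib_left)
  qed
  \<comment> \<open>As \<open>e\<close> is arbitrary, it absorbs the factor
    \<open>t\<close>.\<close>
  then have "(LINT x:A|lebesgue. \<bar>h x\<bar>) \<le> t * measure lebesgue A + e" if "e > 0" for e
    using that t by (metis divide_pos_pos nonzero_mult_div_cancel_left order_less_irrefl times_divide_eq_right)
  then have le: "(LINT x:A|lebesgue. \<bar>h x\<bar>) \<le> t * measure lebesgue A"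
    by (rule field_le_epsilon)
  have intc: "set_integrable lebesgue A (\<lambda>x. t)"
    using Alm unfolding lmeasurable_iff_integrable set_integrable_def by simp
  \<comment> \<open>The integrand is positive on \<open>A\<close> but its integral is at most 0,
    which forces \<open>A\<close> to be null.\<close>
  have "(LINT x:A|lebesgue. \<bar>h x\<bar> - t) = (LINT x:A|lebesgue. \<bar>h x\<bar>) - t * measure lebesgue A"
    using Ams by (subst set_integral_diff(2)[OF intA intc]) (simp add: set_lebesgue_integral_def mult.commute)
  moreover have "0 \<le> (LINT x:A|lebesgue. \<bar>h x\<bar> - t)"
    unfolding set_lebesgue_integral_def by (intro Bochner_Integration.integral_nonneg) (auto simp: A_def indicator_def)
  ultimately have "(LINT x:A|lebesgue. \<bar>h x\<bar> - t) = 0" using le by simp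
  moreover have "set_integrable lebesgue A (\<lambda>x. \<bar>h x\<bar> - t)" by (rule set_integral_diff(1)[OF intA intc])
  ultimately have "AE x in lebesgue. indicator A x *\<^sub>R (\<bar>h x\<bar> - t) = 0"
    unfolding set_lebesgue_integral_def set_integrable_def
    by (subst (asm) integral_nonneg_eq_0_iff_AE) (auto simp: A_def indicator_def)
  then have 3: "AE x in lebesgue. x \<in> R - \<Union>D \<longrightarrow> \<bar>h x\<bar> \<le> t"
    by eventually_elim (auto simp: A_def indicator_def split: if_splits)
  show ?thesis by (rule that[OF D 1 2 3])
qed

section \<open>Iterated stopping rectangles\<close>

text \<open>Jensen's inequality for the weights \<open>c i / sum c I\<close>; undoing the
  normalization leaves the power \<open>p - 1\<close> of the total weight.\<close>

lemma powr_sum_le: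
  fixes b c :: "'i \<Rightarrow> real"
  assumes I: "finite I" "I \<noteq> {}" and c: "\<And>i. i \<in> I \<Longrightarrow> 0 < c i" and b: "\<And>i. i \<in> I \<Longrightarrow> 0 < b i"
    and p: "1 \<le> p"
  shows "(\<Sum>i\<in>I. c i * b i) powr p \<le> sum c I powr (p - 1) * (\<Sum>i\<in>I. c i * b i powr p)"
proof -
  have s: "0 < sum c I" using I c by (intro sum_pos) auto
  have nn: "0 \<le> (\<Sum>i\<in>I. c i * b i)" by (intro sum_nonneg mult_nonneg_nonneg) (use c b in \<open>auto intro: less_imp_le\<close>)
  have "(\<Sum>i\<in>I. (c i / sum c I) *\<^sub>R b i) powr p \<le> (\<Sum>i\<in>I. (c i / sum c I) * b i powr p)"
    by (rule convex_on_sum[OF I powr_convex[OF p]])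
      (use s c b in \<open>auto simp: sum_divide_distrib[symmetric] less_imp_le\<close>)
  then have "(\<Sum>i\<in>I. c i * b i) powr p / sum c I powr p \<le> (\<Sum>i\<in>I. c i * b i powr p) / sum c I"
    using s nn by (simp add: sum_divide_distrib[symmetric] powr_divide)
  then have "(\<Sum>i\<in>I. c i * b i) powr p \<le> (sum c I powr p / sum c I) * (\<Sum>i\<in>I. c i * b i powr p)"
    using s by (simp add: divide_le_eq mult.commute)
  also have "sum c I powr p / sum c I = sum c I powr (p - 1)"
    using s by (simp add: powr_diff)
  finally show ?thesis .
qed

text \<open>Translates the sums of the SD condition into nonnegative integrals, for which Tonelli's
  theorem is available.\<close>

lemma nn_integral_count_space_infsum:
  fixes g :: "'i \<Rightarrow> real"
  assumes "g summable_on D" "\<And>i. i \<in> D \<Longrightarrow> 0 \<le> g i"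
  shows "(\<integral>\<^sup>+i. ennreal (g i) \<partial>count_space D) = ennreal (infsum g D)"
proof -
  have "(\<lambda>x. norm (g x)) summable_on D \<longleftrightarrow> g summable_on D"
    using assms(2) by (intro summable_on_cong) simp
  then have "Infinite_Set_Sum.abs_summable_on g D"
    using assms(1) abs_summable_equivalent by blast
  then show ?thesis
    using nn_integral_conv_infsetsum assms(2) infsetsum_infsum by metis
qed

lemma locally_integrable_rectangle:
  assumes "locally_integrable f" "R \<in> rectangles"
  shows "set_integrable lebesgue R f"
proof -
  obtain l u where "R \<subseteq> cbox l u" using rectangle_subset_cbox[OF assms(2)] .
  moreover have "set_integrable lebesgue (cbox l u) f"
    using assms(1) compact_cbox unfolding locally_integrable_def by simp
  ultimately show ?thesis
    by (intro set_integrable_subset[of lebesgue "cbox l u" f R] rectangle_sets[OF assms(2)])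
qed

text \<open>The Calderon-Zygmund decomposition of the oscillation at height \<open>L * t\<close>.
  Since its mean is at most \<open>t\<close>, the selected set takes up at most the fraction
  \<open>1 / L\<close> of \<open>R\<close>.\<close>

lemma oscillation_step:
  obtains K where "1 \<le> K" and
    "\<And>(f :: real ^ 'n \<Rightarrow> real) R t L. locally_integrable f \<Longrightarrow> R \<in> rectangles \<Longrightarrow> 0 < t \<Longrightarrow> 1 \<le> L \<Longrightarrow>
       avg R (\<lambda>x. \<bar>f x - poly_proj m R f x\<bar>) \<le> t \<Longrightarrow>
       \<exists>D. D \<subseteq> dyadic_subrects R \<and> disjoint D \<and> L * measure lebesgue (\<Union>D) \<le> measure lebesgue R \<and>
         (AE x in lebesgue. x \<in> R - \<Union>D \<longrightarrow> \<bar>f x - poly_proj m R f x\<bar> \<le> K * L * t) \<and>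
         (\<forall>Q\<in>D. \<forall>x\<in>Q. \<bar>poly_proj m Q f x - poly_proj m R f x\<bar> \<le> K * L * t)"
proof -
  obtain C where C: "C > 0"
    and bound: "\<And>(R :: (real ^ 'n) set) f x. R \<in> rectangles \<Longrightarrow> set_integrable lebesgue R f \<Longrightarrow> x \<in> R \<Longrightarrow>
     \<bar>poly_proj m R f x\<bar> \<le> C * avg R (\<lambda>x. \<bar>f x\<bar>)"
    by (rule poly_proj_bound[of m]) (rule that, assumption+)
  \<comment> \<open>The 1 serves the bound off the selected rectangles. In the other term,
    \<open>C\<close> comes from the projection bound and the power of 2 from passing from a parent
    to its child.\<close>
  define K where "K = max 1 (C * 2 ^ CARD('n))"
  have K: "1 \<le> K" "C * 2 ^ CARD('n) \<le> K" by (auto simp: K_def)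
  show ?thesis
  proof (rule that[OF K(1)])
    fix f :: "real ^ 'n \<Rightarrow> real" and R t L
    assume f: "locally_integrable f" and R: "R \<in> rectangles" and t: "0 < t" and L: "1 \<le> (L::real)"
      and av: "avg R (\<lambda>x. \<bar>f x - poly_proj m R f x\<bar>) \<le> t"
    let ?h = "\<lambda>x. f x - poly_proj m R f x"
    have h: "set_integrable lebesgue Q ?h" if "Q \<in> rectangles" for Q
      using locally_integrable_rectangle[OF f that] set_integrable_polys[OF that poly_proj_polys[OF R]]
      by (rule set_integral_diff(1))
    have Lt: "0 < L * t" "t \<le> L * t" using t L by auto
    obtain D where D: "D \<subseteq> dyadic_subrects R" "disjoint D"
      "(L * t) * measure lebesgue (\<Union>D) \<le> (LINT x:R|lebesgue. \<bar>?h x\<bar>)"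
      "\<And>Q. Q \<in> D \<Longrightarrow> avg Q (\<lambda>x. \<bar>?h x\<bar>) \<le> 2 ^ CARD('n) * (L * t)"
      "AE x in lebesgue. x \<in> R - \<Union>D \<longrightarrow> \<bar>?h x\<bar> \<le> L * t"
      using calderon_zygmund[OF R h[OF R] Lt(1) order_trans[OF av Lt(2)]] by blast
    have "(LINT x:R|lebesgue. \<bar>?h x\<bar>) \<le> t * measure lebesgue R"
      using av rectangles_measure(2)[OF R] by (simp add: avg_def divide_le_eq)
    then have "t * (L * measure lebesgue (\<Union>D)) \<le> t * measure lebesgue R" using D(3) by (simp add: mult_ac)
    then have 1: "L * measure lebesgue (\<Union>D) \<le> measure lebesgue R" using t by simp
    have "L * t \<le> K * L * t" using mult_right_mono[OF K(1), of "L * t"] Lt(1) by (simp add: mult.assoc)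
    then have 2: "AE x in lebesgue. x \<in> R - \<Union>D \<longrightarrow> \<bar>?h x\<bar> \<le> K * L * t"
      using D(5) by (auto elim!: eventually_mono)
    have 3: "\<bar>poly_proj m Q f x - poly_proj m R f x\<bar> \<le> K * L * t" if Q: "Q \<in> D" and x: "x \<in> Q" for Q x
    proof -
      have Qr: "Q \<in> rectangles" using Q D(1) R dyadic_subrects_rectangle by blast
      have "poly_proj m Q f x - poly_proj m R f x = poly_proj m Q ?h x"
        using poly_proj_subrect[OF R Qr locally_integrable_rectangle[OF f Qr]] by simp
      also have "\<bar>\<dots>\<bar> \<le> C * avg Q (\<lambda>x. \<bar>?h x\<bar>)" by (rule bound[OF Qr h[OF Qr] x])
      also have "\<dots> \<le> C * (2 ^ CARD('n) * (L * t))" using C D(4)[OF Q] by simp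
      also have "\<dots> \<le> K * (L * t)" using mult_right_mono[OF K(2), of "L * t"] Lt by (simp add: mult_ac)
      finally show ?thesis by (simp add: mult.assoc)
    qed
    show "\<exists>D. D \<subseteq> dyadic_subrects R \<and> disjoint D \<and> L * measure lebesgue (\<Union>D) \<le> measure lebesgue R \<and>
         (AE x in lebesgue. x \<in> R - \<Union>D \<longrightarrow> \<bar>f x - poly_proj m R f x\<bar> \<le> K * L * t) \<and>
         (\<forall>Q\<in>D. \<forall>x\<in>Q. \<bar>poly_proj m Q f x - poly_proj m R f x\<bar> \<le> K * L * t)"
      using D(1,2) 1 2 3 by blast
  qed
qed

section \<open>Generations of selected rectangles\<close>

primrec generation :: "('a set \<Rightarrow> 'a set set) \<Rightarrow> 'a set \<Rightarrow> nat \<Rightarrow> 'a set set" where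
  "generation S R 0 = {R}"
| "generation S R (Suc k) = (\<Union>Q\<in>generation S R k. S Q)"

text \<open>Disjointness within a generation will make the choice unique; for a point in no member
  of generation \<open>k\<close> the value is unspecified.\<close>

definition gen_rect :: "('a set \<Rightarrow> 'a set set) \<Rightarrow> 'a set \<Rightarrow> nat \<Rightarrow> 'a \<Rightarrow> 'a set" where
  "gen_rect S R k x = (SOME Q. Q \<in> generation S R k \<and> x \<in> Q)"

locale stopping_rects =
  fixes S :: "(real ^ 'n) set \<Rightarrow> (real ^ 'n) set set" and R :: "(real ^ 'n) set" and L :: real
  assumes R: "R \<in> rectangles" and L: "1 < L"
    and S_sub: "\<And>Q. Q \<in> rectangles \<Longrightarrow> S Q \<subseteq> dyadic_subrects Q"
    and S_disj: "\<And>Q. Q \<in> rectangles \<Longrightarrow> disjoint (S Q)"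
    and S_meas: "\<And>Q. Q \<in> rectangles \<Longrightarrow> L * measure lebesgue (\<Union>(S Q)) \<le> measure lebesgue Q"
begin

lemma generation_subrects: "generation S R k \<subseteq> dyadic_subrects R"
proof (induction k)
  case (Suc k)
  show ?case
  proof
    fix Q assume "Q \<in> generation S R (Suc k)"
    then obtain Q' where Q': "Q' \<in> generation S R k" "Q \<in> S Q'" by auto
    then have "Q' \<in> dyadic_subrects R" using Suc by blast
    then show "Q \<in> dyadic_subrects R"
      using Q'(2) S_sub dyadic_subrects_rectangle[OF _ R] dyadic_subrects_trans by blast
  qed
qed (auto intro: dyadic_subrects.self)

lemma generation_rectangle: "Q \<in> generation S R k \<Longrightarrow> Q \<in> rectangles"
  using generation_subrects dyadic_subrects_rectangle[OF _ R] by blast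

lemma Union_stopping_subset: "Q \<in> rectangles \<Longrightarrow> \<Union>(S Q) \<subseteq> Q"
  using S_sub dyadic_subrects_subset by blast

text \<open>A common point of two members of the next generation lies in both parents. These
  coincide by induction, and the family selected in one parent is disjoint.\<close>

lemma generation_disjoint: "disjoint (generation S R k)"
proof (induction k)
  case (Suc k)
  have "A = B" if A: "A \<in> generation S R (Suc k)" and B: "B \<in> generation S R (Suc k)"
      and x: "x \<in> A" "x \<in> B" for A B x
  proof -
    obtain A' where A': "A' \<in> generation S R k" "A \<in> S A'" using A by auto
    obtain B' where B': "B' \<in> generation S R k" "B \<in> S B'" using B by auto
    have r: "A' \<in> rectangles" "B' \<in> rectangles" using A' B' generation_rectangle by auto
    have "x \<in> A'" "x \<in> B'" using x A' B' Union_stopping_subset r by blast+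
    then have "A' = B'" using Suc A'(1) B'(1) unfolding disjoint_def by blast
    then show ?thesis using S_disj[OF r(1)] A'(2) B'(2) x unfolding disjoint_def by blast
  qed
  then show ?case unfolding disjoint_def by blast
qed (simp add: disjoint_def)

lemmas generation_Union_sets = dyadic_Union_sets[OF R generation_subrects]

text \<open>The gain \<open>L\<close> inside each rectangle is summed over a disjoint generation;
  putting \<open>L\<close> into the density of a measure lets \<open>emeasure_UN_le\<close> do the
  summation.\<close>

lemma generation_measure: "L ^ k * measure lebesgue (\<Union>(generation S R k)) \<le> measure lebesgue R"
proof (induction k)
  case (Suc k)
  let ?G = "generation S R k" and ?T = "density (lebesgue :: (real^'n) measure) (\<lambda>_. ennreal L)"
  have r: "Q \<in> rectangles" if "Q \<in> ?G" for Q using that by (rule generation_rectangle)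
  have dG: "disjoint_family_on (\<lambda>Q. Q) ?G" by (rule disjoint_family_on_id[OF generation_disjoint])
  have "emeasure ?T (\<Union>Q\<in>?G. \<Union>(S Q)) \<le> emeasure lebesgue (\<Union>Q\<in>?G. Q)"
  proof (rule emeasure_UN_le)
    show "disjoint_family_on (\<lambda>Q. \<Union>(S Q)) ?G"
      using dG Union_stopping_subset[OF r] unfolding disjoint_family_on_def by blast
    fix Q assume Q: "Q \<in> ?G"
    note U = dyadic_Union_sets[OF r[OF Q] S_sub[OF r[OF Q]]]
    show "\<Union>(S Q) \<in> sets ?T" using U(1) by simp
    have "emeasure ?T (\<Union>(S Q)) = ennreal (L * measure lebesgue (\<Union>(S Q)))"
      using L U(2) by (intro emeasure_density_const_lebesgue) auto
    also have "\<dots> \<le> ennreal (measure lebesgue Q)" by (rule ennreal_leI[OF S_meas[OF r[OF Q]]])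
    also have "\<dots> = emeasure lebesgue Q"
      using rectangles_measure(1)[OF r[OF Q]] by (simp add: emeasure_eq_measure2)
    finally show "emeasure ?T (\<Union>(S Q)) \<le> emeasure lebesgue Q" .
  qed (use generation_Union_sets(4) r dG in \<open>auto intro: rectangle_sets\<close>)
  moreover have "(\<Union>Q\<in>?G. \<Union>(S Q)) = \<Union>(generation S R (Suc k))" by auto
  moreover have "emeasure ?T (\<Union>(generation S R (Suc k))) = ennreal (L * measure lebesgue (\<Union>(generation S R (Suc k))))"
    using L by (intro emeasure_density_const_lebesgue[OF generation_Union_sets(2)]) simp
  moreover have "emeasure lebesgue (\<Union>Q\<in>?G. Q) = ennreal (measure lebesgue (\<Union>?G))"
    using generation_Union_sets(2)[of k] by (simp add: emeasure_eq_measure2)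
  ultimately have "ennreal (L * measure lebesgue (\<Union>(generation S R (Suc k)))) \<le> ennreal (measure lebesgue (\<Union>?G))"
    by simp
  then have "L * measure lebesgue (\<Union>(generation S R (Suc k))) \<le> measure lebesgue (\<Union>?G)"
    by (simp add: ennreal_le_iff)
  then have "L ^ k * (L * measure lebesgue (\<Union>(generation S R (Suc k)))) \<le> L ^ k * measure lebesgue (\<Union>?G)"
    using L by (intro mult_left_mono) auto
  then show ?case using Suc by (simp add: mult_ac)
qed simp

text \<open>A point that never stops lies in the union of every generation, and these have measure
  at most that of \<open>R\<close> over \<open>L ^ k\<close>, which tends to 0.\<close>

lemma AE_eventually_stops: "AE x in lebesgue. \<exists>k. x \<notin> \<Union>(generation S R k)"
proof -
  let ?U = "\<lambda>k. \<Union>(generation S R k)"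
  have s: "(\<Inter>k. ?U k) \<in> lmeasurable"
    by (rule fmeasurableI2[OF generation_Union_sets(2)[of 0]])
      (auto intro!: sets.countable_INT'' generation_Union_sets(1) simp del: generation.simps)
  have "measure lebesgue (\<Inter>k. ?U k) \<le> measure lebesgue R / L ^ k" for k
  proof -
    have "measure lebesgue (\<Inter>k. ?U k) \<le> measure lebesgue (?U k)"
      using s generation_Union_sets(2)[of k] by (intro measure_mono_fmeasurable) auto
    then show ?thesis using generation_measure[of k] L by (simp add: le_divide_eq mult.commute) (smt (verit) mult_left_mono zero_le_power)
  qed
  moreover have "(\<lambda>k. measure lebesgue R / L ^ k) \<longlonglongrightarrow> 0"
    using L by (rule LIMSEQ_divide_realpow_zero)
  ultimately have "measure lebesgue (\<Inter>k. ?U k) \<le> 0"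
    by (intro LIMSEQ_le_const) auto
  then have "(\<Inter>k. ?U k) \<in> null_sets lebesgue"
    using s measure_nonneg[of lebesgue "\<Inter>k. ?U k"] by (intro null_setsI) (auto simp: emeasure_eq_measure2)
  then show ?thesis by (auto dest: AE_not_in)
qed

lemma gen_rect_eq:
  assumes "Q \<in> generation S R k" "x \<in> Q" shows "gen_rect S R k x = Q"
  unfolding gen_rect_def
  by (rule some_equality) (use assms generation_disjoint[of k] in \<open>auto simp: disjoint_def\<close>)

lemma gen_rect_mem:
  assumes "x \<in> \<Union>(generation S R k)"
  shows "gen_rect S R k x \<in> generation S R k" "x \<in> gen_rect S R k x"
  using assms gen_rect_eq by auto

text \<open>\<open>n\<close> is the first generation that misses \<open>x\<close>. The terms with
  \<open>j < n - 1\<close> bound the successive jumps of the projections, and the last one bounds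
  the distance of \<open>f\<close> from the final projection.\<close>

lemma AE_telescope:
  fixes f :: "real ^ 'n \<Rightarrow> real" and P :: "(real ^ 'n) set \<Rightarrow> real ^ 'n \<Rightarrow> real" and b :: "(real ^ 'n) set \<Rightarrow> real"
  assumes jump: "\<And>Q Q' x. Q \<in> rectangles \<Longrightarrow> Q' \<in> S Q \<Longrightarrow> x \<in> Q' \<Longrightarrow> \<bar>P Q' x - P Q x\<bar> \<le> b Q"
    and stop: "\<And>Q. Q \<in> rectangles \<Longrightarrow> AE x in lebesgue. x \<in> Q - \<Union>(S Q) \<longrightarrow> \<bar>f x - P Q x\<bar> \<le> b Q"
  shows "AE x in lebesgue. x \<in> R \<longrightarrow> (\<exists>n>0. (\<forall>j<n. x \<in> \<Union>(generation S R j)) \<and>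
           \<bar>f x - P R x\<bar> \<le> (\<Sum>j<n. b (gen_rect S R j x)))"
proof -
  have tele: "\<bar>P (gen_rect S R k x) x - P R x\<bar> \<le> (\<Sum>j<k. b (gen_rect S R j x))"
    if "x \<in> \<Union>(generation S R k)" for k x
    using that
  proof (induction k)
    case 0
    then have "gen_rect S R 0 x = R" by (intro gen_rect_eq) auto
    then show ?case by simp
  next
    case (Suc k)
    then obtain Q Q' where Q: "Q \<in> generation S R k" "Q' \<in> S Q" "x \<in> Q'" by auto
    have Qr: "Q \<in> rectangles" using generation_rectangle Q(1) .
    have xQ: "x \<in> Q" using Union_stopping_subset[OF Qr] Q by blast
    have 1: "gen_rect S R k x = Q" using gen_rect_eq[OF Q(1) xQ] .
    have 2: "gen_rect S R (Suc k) x = Q'" using Q by (intro gen_rect_eq) auto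
    have "\<bar>P Q x - P R x\<bar> \<le> (\<Sum>j<k. b (gen_rect S R j x))" using Suc.IH xQ Q(1) 1 by auto
    moreover have "\<bar>P Q' x - P Q x\<bar> \<le> b Q" using jump[OF Qr Q(2,3)] .
    ultimately show ?case unfolding 2 by (simp add: 1)
  qed
  \<comment> \<open>Generations are countable, so the exceptional null sets can be collected into
    one.\<close>
  have "AE x in lebesgue. \<forall>Q\<in>generation S R k. x \<in> Q - \<Union>(S Q) \<longrightarrow> \<bar>f x - P Q x\<bar> \<le> b Q" for k
    using generation_Union_sets(4)[of k] stop generation_rectangle by (subst AE_ball_countable) auto
  then have "AE x in lebesgue. \<forall>k. \<forall>Q\<in>generation S R k. x \<in> Q - \<Union>(S Q) \<longrightarrow> \<bar>f x - P Q x\<bar> \<le> b Q"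
    by (simp add: AE_all_countable)
  with AE_eventually_stops show ?thesis
  proof eventually_elim
    case (elim x)
    show ?case
    proof
      assume x: "x \<in> R"
      define n where "n = (LEAST k. x \<notin> \<Union>(generation S R k))"
      have n: "x \<notin> \<Union>(generation S R n)" unfolding n_def by (rule LeastI_ex) (use elim(1) in blast)
      have lt: "x \<in> \<Union>(generation S R j)" if "j < n" for j
        using not_less_Least that unfolding n_def by blast
      \<comment> \<open>Generation 0 consists of \<open>R\<close>, which contains
        \<open>x\<close>.\<close>
      have "n \<noteq> 0" using n x by (metis UnionI generation.simps(1) singletonI)
      then obtain k where k: "n = Suc k" using not0_implies_Suc by blast
      let ?Q = "gen_rect S R k x"
      have Q: "?Q \<in> generation S R k" "x \<in> ?Q" using gen_rect_mem lt k by auto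
      have "x \<notin> \<Union>(S ?Q)" using n Q(1) k by auto
      then have "\<bar>f x - P ?Q x\<bar> \<le> b ?Q" using elim(2) Q by blast
      moreover have "\<bar>P ?Q x - P R x\<bar> \<le> (\<Sum>j<k. b (gen_rect S R j x))" using tele lt k by blast
      ultimately have "\<bar>f x - P R x\<bar> \<le> (\<Sum>j<n. b (gen_rect S R j x))" by (simp add: k)
      then show "\<exists>n>0. (\<forall>j<n. x \<in> \<Union>(generation S R j)) \<and> \<bar>f x - P R x\<bar> \<le> (\<Sum>j<n. b (gen_rect S R j x))"
        using lt k by (intro exI[of _ n]) auto
    qed
  qed
qed

end

section \<open>The weighted estimate\<close>

lemma emeasure_weight:
  assumes w: "weight w" and Q: "Q \<in> rectangles"
  shows "(\<integral>\<^sup>+x. ennreal (w x) * indicator Q x \<partial>lebesgue) = ennreal (wmeas w Q)"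
proof -
  have "integrable lebesgue (\<lambda>x. indicator Q x *\<^sub>R w x)"
    using locally_integrable_rectangle[OF _ Q] w by (auto simp: weight_def set_integrable_def)
  then have "(\<integral>\<^sup>+x. ennreal (indicator Q x *\<^sub>R w x) \<partial>lebesgue) = ennreal (wmeas w Q)"
    unfolding wmeas_def set_lebesgue_integral_def
    using w by (intro nn_integral_eq_integral) (auto simp: weight_def)
  moreover have "(\<integral>\<^sup>+x. ennreal (w x) * indicator Q x \<partial>lebesgue) = (\<integral>\<^sup>+x. ennreal (indicator Q x *\<^sub>R w x) \<partial>lebesgue)"
    by (intro nn_integral_cong) (auto simp: indicator_def)
  ultimately show ?thesis by simp
qed

lemma wmeas_nonneg: "weight w \<Longrightarrow> 0 \<le> wmeas w Q"
  unfolding wmeas_def set_lebesgue_integral_def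
  by (intro Bochner_Integration.integral_nonneg) (auto simp: weight_def)

text \<open>Were the integral zero, \<open>w\<close> would vanish a.e. on \<open>R\<close>, and a.e.
  positivity would make \<open>R\<close> null. This legitimates division by
  \<open>wmeas w R\<close>.\<close>

lemma wmeas_pos:
  assumes w: "weight w" "AE x in lebesgue. 0 < w x" and R: "R \<in> rectangles"
  shows "0 < wmeas w R"
proof (rule ccontr)
  assume "\<not> 0 < wmeas w R"
  then have z: "wmeas w R = 0" using wmeas_nonneg[OF w(1), of R] by simp
  have "integrable lebesgue (\<lambda>x. indicator R x *\<^sub>R w x)"
    using locally_integrable_rectangle[OF _ R] w(1) by (auto simp: weight_def set_integrable_def)
  then have "AE x in lebesgue. indicator R x *\<^sub>R w x = 0"
    using z w(1) unfolding wmeas_def set_lebesgue_integral_def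
    by (subst (asm) integral_nonneg_eq_0_iff_AE) (auto simp: weight_def)
  with w(2) have "AE x in lebesgue. x \<notin> R"
    by eventually_elim (auto simp: indicator_def split: if_splits)
  then have "emeasure lebesgue R = 0"
    using rectangle_sets[OF R] by (subst (asm) AE_iff_measurable[of R]) (auto simp: sets.sets_into_space)
  then show False using rectangles_measure(2)[OF R] by (simp add: measure_def)
qed

text \<open>In place of Minkowski's inequality for the sum over generations, Jensen's inequality is used with the
  weights \<open>\<theta> ^ j\<close>, by which the \<open>j\<close>-th norm is known to decay.\<close>
lemma generation_sum_weighted:
  fixes R :: "(real ^ 'n) set" and G :: "nat \<Rightarrow> (real ^ 'n) set set"
  assumes R: "R \<in> rectangles" and w: "weight w" and p: "1 \<le> p"
    and a: "\<And>Q. Q \<in> rectangles \<Longrightarrow> 0 < a Q"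
    and \<theta>: "0 < \<theta>" "\<theta> < 1" and MA: "0 \<le> M" "0 \<le> A"
    and G: "\<And>j. G j \<subseteq> dyadic_subrects R"
    and q: "\<And>j x. x \<in> \<Union>(G j) \<Longrightarrow> q j x \<in> G j \<and> x \<in> q j x"
    and g: "AE x in lebesgue. x \<in> R \<longrightarrow> (\<exists>n>0. (\<forall>j<n. x \<in> \<Union>(G j)) \<and> \<bar>g x\<bar> \<le> (\<Sum>j<n. M * a (q j x)))"
    and decay: "\<And>j. (\<integral>\<^sup>+Q. ennreal (a Q powr p * wmeas w Q) \<partial>count_space (G j)) \<le> ennreal ((\<theta> ^ j * A) powr p * wmeas w R)"
  shows "(\<integral>\<^sup>+x. ennreal (\<bar>g x\<bar> powr p * w x) * indicator R x \<partial>lebesgue) \<le> ennreal ((M * A / (1 - \<theta>)) powr p * wmeas w R)"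
proof -
  let ?D = "dyadic_subrects R"
  define \<Lambda> where "\<Lambda> = 1 / (1 - \<theta>)"
  have \<Lambda>: "0 < \<Lambda>" using \<theta> by (simp add: \<Lambda>_def)
  \<comment> \<open>The coefficient of \<open>a Q powr p\<close> after Jensen:
    \<open>\<theta> ^ j * (a Q / \<theta> ^ j) powr p\<close> supplies the quotient of powers of
    \<open>\<theta>\<close>, and \<open>\<Lambda>\<close> bounds the total weight.\<close>
  define c where "c j = M powr p * \<Lambda> powr (p - 1) * (\<theta> ^ j / (\<theta> ^ j) powr p)" for j
  have c: "0 \<le> c j" for j using \<theta> by (simp add: c_def)
  define T where "T Q x = ennreal (a Q powr p) * (ennreal (w x) * indicator Q x)" for Q x
  have r: "Q \<in> rectangles" if "Q \<in> ?D" for Q using that R dyadic_subrects_rectangle by blast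
  have wi: "(\<lambda>x. ennreal (w x) * indicator Q x) \<in> borel_measurable lebesgue" if "Q \<in> rectangles" for Q
  proof -
    have "(\<lambda>x. indicator Q x *\<^sub>R w x) \<in> borel_measurable lebesgue"
      using locally_integrable_rectangle[OF _ that] w by (auto simp: weight_def set_integrable_def)
    then have "(\<lambda>x. ennreal (indicator Q x *\<^sub>R w x)) \<in> borel_measurable lebesgue" by measurable
    also have "(\<lambda>x. ennreal (indicator Q x *\<^sub>R w x)) = (\<lambda>x. ennreal (w x) * indicator Q x)"
      by (auto simp: indicator_def)
    finally show ?thesis .
  qed
  have T: "T Q \<in> borel_measurable lebesgue" if "Q \<in> ?D" for Q
    using wi[OF r[OF that]] unfolding T_def by measurable
  \<comment> \<open>The rectangles \<open>q j x\<close> vary with \<open>x\<close>. They are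
    replaced by a sum over all dyadic subrectangles, where \<open>T Q x\<close> vanishes off
    \<open>Q\<close>, so that each \<open>Q\<close> can be integrated separately.\<close>
  have pw: "ennreal (\<bar>g x\<bar> powr p * w x) \<le> (\<integral>\<^sup>+Q. (\<Sum>j. ennreal (c j) * indicator (G j) Q) * T Q x \<partial>count_space ?D)"
    if n: "n > 0" "\<And>j. j < n \<Longrightarrow> x \<in> \<Union>(G j)" "\<bar>g x\<bar> \<le> (\<Sum>j<n. M * a (q j x))" for x n
  proof -
    have qj: "q j x \<in> G j" "x \<in> q j x" "0 < a (q j x)" "q j x \<in> ?D" if "j < n" for j
      using q[OF n(2)[OF that]] G r a by blast+
    have w0: "0 \<le> w x" using w by (simp add: weight_def)
    have "(\<Sum>j<n. a (q j x)) = (\<Sum>j<n. \<theta> ^ j * (a (q j x) / \<theta> ^ j))"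
      using \<theta> by (intro sum.cong) auto
    also have "\<dots> powr p \<le> (\<Sum>j<n. \<theta> ^ j) powr (p - 1) * (\<Sum>j<n. \<theta> ^ j * (a (q j x) / \<theta> ^ j) powr p)"
      using n(1) qj \<theta> p by (intro powr_sum_le) auto
    also have "\<dots> \<le> \<Lambda> powr (p - 1) * (\<Sum>j<n. \<theta> ^ j * (a (q j x) / \<theta> ^ j) powr p)"
    proof (intro mult_right_mono powr_mono2 sum_nonneg)
      have "(\<Sum>j<n. \<theta> ^ j) = (1 - \<theta> ^ n) / (1 - \<theta>)" using \<theta> by (simp add: sum_gp_strict)
      also have "\<dots> \<le> \<Lambda>" unfolding \<Lambda>_def using \<theta> by (intro divide_right_mono) auto
      finally show "(\<Sum>j<n. \<theta> ^ j) \<le> \<Lambda>" .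
    qed (use \<theta> p in auto)
    finally have 1: "(\<Sum>j<n. a (q j x)) powr p \<le> \<Lambda> powr (p - 1) * (\<Sum>j<n. \<theta> ^ j * (a (q j x) / \<theta> ^ j) powr p)" .
    have "\<bar>g x\<bar> powr p \<le> (M * (\<Sum>j<n. a (q j x))) powr p"
      using n(3) p by (intro powr_mono2) (auto simp: sum_distrib_left)
    also have "\<dots> = M powr p * (\<Sum>j<n. a (q j x)) powr p"
      using MA(1) qj by (intro powr_mult) 
    also have "\<dots> \<le> M powr p * (\<Lambda> powr (p - 1) * (\<Sum>j<n. \<theta> ^ j * (a (q j x) / \<theta> ^ j) powr p))"
      using 1 by (intro mult_left_mono) auto
    also have "\<dots> = (\<Sum>j<n. c j * a (q j x) powr p)"
      using \<theta> qj(3) by (simp add: c_def sum_distrib_left powr_divide less_imp_le mult_ac)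
    finally have "\<bar>g x\<bar> powr p * w x \<le> (\<Sum>j<n. c j * a (q j x) powr p) * w x"
      using w0 by (intro mult_right_mono)
    then have "ennreal (\<bar>g x\<bar> powr p * w x) \<le> ennreal (\<Sum>j<n. c j * a (q j x) powr p * w x)"
      by (intro ennreal_leI) (simp add: sum_distrib_right)
    also have "\<dots> = (\<Sum>j<n. ennreal (c j * a (q j x) powr p * w x))"
      using c w0 by (intro sum_ennreal[symmetric]) auto
    also have "\<dots> \<le> (\<Sum>j<n. \<integral>\<^sup>+Q. ennreal (c j) * indicator (G j) Q * T Q x \<partial>count_space ?D)"
    proof (rule sum_mono)
      fix j assume "j \<in> {..<n}"
      then have j: "j < n" by simp
      have "ennreal (c j * a (q j x) powr p * w x) = ennreal (c j) * indicator (G j) (q j x) * T (q j x) x"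
        using qj[OF j] c w0 by (simp add: T_def ennreal_mult mult.assoc)
      also have "\<dots> \<le> (\<integral>\<^sup>+Q. ennreal (c j) * indicator (G j) Q * T Q x \<partial>count_space ?D)"
        by (rule nn_integral_ge_point[OF qj(4)[OF j]])
      finally show "ennreal (c j * a (q j x) powr p * w x) \<le> \<dots>" .
    qed
    also have "\<dots> \<le> (\<Sum>j. \<integral>\<^sup>+Q. ennreal (c j) * indicator (G j) Q * T Q x \<partial>count_space ?D)"
      by (intro sum_le_suminf) auto
    also have "\<dots> = (\<integral>\<^sup>+Q. (\<Sum>j. ennreal (c j) * indicator (G j) Q) * T Q x \<partial>count_space ?D)"
      by (subst nn_integral_suminf[symmetric]) (auto simp: ennreal_suminf_multc)
    finally show ?thesis .
  qed
  have "(\<integral>\<^sup>+x. ennreal (\<bar>g x\<bar> powr p * w x) * indicator R x \<partial>lebesgue) \<le>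
      (\<integral>\<^sup>+x. (\<integral>\<^sup>+Q. (\<Sum>j. ennreal (c j) * indicator (G j) Q) * T Q x \<partial>count_space ?D) \<partial>lebesgue)"
  proof (rule nn_integral_mono_AE)
    show "AE x in lebesgue. ennreal (\<bar>g x\<bar> powr p * w x) * indicator R x \<le>
      (\<integral>\<^sup>+Q. (\<Sum>j. ennreal (c j) * indicator (G j) Q) * T Q x \<partial>count_space ?D)"
      using g
    proof eventually_elim
      case (elim x)
      then show ?case using pw by (cases "x \<in> R") auto
    qed
  qed
  \<comment> \<open>Tonelli's theorem for Lebesgue measure and counting measure on a countable
    set.\<close>
  also have "\<dots> = (\<integral>\<^sup>+Q. (\<integral>\<^sup>+x. (\<Sum>j. ennreal (c j) * indicator (G j) Q) * T Q x \<partial>lebesgue) \<partial>count_space ?D)"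
    using T by (intro nn_integral_count_space_nn_integral countable_dyadic_subrects borel_measurable_times_ennreal) auto
  also have "\<dots> = (\<integral>\<^sup>+Q. (\<Sum>j. ennreal (c j) * indicator (G j) Q) * ennreal (a Q powr p * wmeas w Q) \<partial>count_space ?D)"
  proof (rule nn_integral_cong)
    fix Q assume "Q \<in> space (count_space ?D)"
    then have Q: "Q \<in> ?D" by simp
    have "(\<integral>\<^sup>+x. T Q x \<partial>lebesgue) = ennreal (a Q powr p) * ennreal (wmeas w Q)"
      unfolding T_def using wi[OF r[OF Q]] emeasure_weight[OF w r[OF Q]] by (simp add: nn_integral_cmult)
    then show "(\<integral>\<^sup>+x. (\<Sum>j. ennreal (c j) * indicator (G j) Q) * T Q x \<partial>lebesgue) =
        (\<Sum>j. ennreal (c j) * indicator (G j) Q) * ennreal (a Q powr p * wmeas w Q)"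
      using T[OF Q] wmeas_nonneg[OF w] by (simp add: nn_integral_cmult ennreal_mult)
  qed
  also have "\<dots> = (\<Sum>j. \<integral>\<^sup>+Q. ennreal (c j) * indicator (G j) Q * ennreal (a Q powr p * wmeas w Q) \<partial>count_space ?D)"
    by (subst nn_integral_suminf[symmetric]) (auto simp: ennreal_suminf_multc)
  also have "\<dots> \<le> (\<Sum>j. ennreal (M powr p * \<Lambda> powr (p - 1) * A powr p * wmeas w R * \<theta> ^ j))"
  proof (intro suminf_le)
    fix j
    have "(\<integral>\<^sup>+Q. ennreal (c j) * indicator (G j) Q * ennreal (a Q powr p * wmeas w Q) \<partial>count_space ?D)
        = ennreal (c j) * (\<integral>\<^sup>+Q. ennreal (a Q powr p * wmeas w Q) * indicator (G j) Q \<partial>count_space ?D)"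
      by (subst nn_integral_cmult[symmetric]) (auto simp: mult_ac)
    also have "(\<integral>\<^sup>+Q. ennreal (a Q powr p * wmeas w Q) * indicator (G j) Q \<partial>count_space ?D)
        = (\<integral>\<^sup>+Q. ennreal (a Q powr p * wmeas w Q) * indicator (G j) Q * indicator ?D Q \<partial>count_space UNIV)"
      by (simp add: nn_integral_count_space_indicator)
    also have "\<dots> = (\<integral>\<^sup>+Q. ennreal (a Q powr p * wmeas w Q) * indicator (G j) Q \<partial>count_space UNIV)"
      using G[of j] by (intro nn_integral_cong) (auto simp: indicator_def)
    also have "\<dots> = (\<integral>\<^sup>+Q. ennreal (a Q powr p * wmeas w Q) \<partial>count_space (G j))"
      by (simp add: nn_integral_count_space_indicator)
    also have "ennreal (c j) * \<dots> \<le> ennreal (c j) * ennreal ((\<theta> ^ j * A) powr p * wmeas w R)"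
      by (intro mult_left_mono decay) simp
    also have "\<dots> = ennreal (c j * ((\<theta> ^ j * A) powr p * wmeas w R))"
      using c wmeas_nonneg[OF w] by (simp add: ennreal_mult)
    \<comment> \<open>The factors \<open>(\<theta> ^ j) powr p\<close> cancel, and a single
      \<open>\<theta> ^ j\<close> survives to make the series converge.\<close>
    also have "c j * ((\<theta> ^ j * A) powr p * wmeas w R) = M powr p * \<Lambda> powr (p - 1) * A powr p * wmeas w R * \<theta> ^ j"
      using \<theta> MA by (simp add: c_def powr_mult)
    finally show "(\<integral>\<^sup>+Q. ennreal (c j) * indicator (G j) Q * ennreal (a Q powr p * wmeas w Q) \<partial>count_space ?D)
      \<le> ennreal (M powr p * \<Lambda> powr (p - 1) * A powr p * wmeas w R * \<theta> ^ j)" .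
  qed auto
  also have "\<dots> = ennreal (\<Sum>j. M powr p * \<Lambda> powr (p - 1) * A powr p * wmeas w R * \<theta> ^ j)"
    using \<theta> wmeas_nonneg[OF w] by (intro suminf_ennreal2 summable_mult summable_geometric) auto
  also have "(\<Sum>j. M powr p * \<Lambda> powr (p - 1) * A powr p * wmeas w R * \<theta> ^ j) = M powr p * \<Lambda> powr (p - 1) * A powr p * wmeas w R * \<Lambda>"
    using \<theta> by (simp add: suminf_mult suminf_geometric summable_geometric \<Lambda>_def)
  also have "\<dots> = (M * A / (1 - \<theta>)) powr p * wmeas w R"
  proof -
    \<comment> \<open>The power \<open>p - 1\<close> stems from Jensen, the remaining factor from
      the geometric series.\<close>
    have "\<Lambda> powr (p - 1) * \<Lambda> = \<Lambda> powr p" using \<Lambda> by (simp add: powr_diff)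
    moreover have "(M * A / (1 - \<theta>)) = M * A * \<Lambda>" by (simp add: \<Lambda>_def)
    ultimately show ?thesis using MA \<Lambda> by (simp add: powr_mult mult_ac)
  qed
  finally show ?thesis .
qed

section \<open>The constant of the SD condition\<close>

text \<open>The condition is tested on the unit cube with the family consisting of the cube alone,
  where both ratios of measures are 1.\<close>

lemma SD_bound_ge_1:
  fixes w :: "real ^ 'n \<Rightarrow> real"
  assumes w: "weight w" "AE x in lebesgue. 0 < w x" and p: "1 \<le> p"
    and a: "\<And>Q. Q \<in> rectangles \<Longrightarrow> 0 < a Q" and c: "SD_bound s p w a c"
  shows "1 \<le> c"
proof -
  let ?R = "cbox 0 1 :: (real ^ 'n) set"
  have R: "?R \<in> rectangles" by (rule unit_cube_rectangle)
  have "(\<Sum>\<^sub>\<infinity>Q\<in>{?R}. a Q powr p * (wmeas w Q / wmeas w ?R)) powr (1 / p)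
      \<le> c * (measure lebesgue (\<Union>{?R}) / measure lebesgue ?R) powr (1 / s) * a ?R"
    using c R unfolding SD_bound_def
    by (elim ballE[of _ _ ?R] allE[of _ "{?R}"]) (auto simp: disjoint_def intro: dyadic_subrects.self)
  then have "a ?R \<le> c * a ?R"
    using wmeas_pos[OF w R] rectangles_measure(2)[OF R] a[OF R] p by (simp add: powr_powr)
  then show ?thesis using a[OF R] by simp
qed

text \<open>The defining inequality is closed in \<open>c\<close>, so it passes to the infimum. The
  lower bound 1 makes \<open>Inf\<close> a genuine infimum and later lets powers of the norm be
  dropped from denominators.\<close>

lemma SD_bound_SD_norm:
  fixes w :: "real ^ 'n \<Rightarrow> real"
  assumes w: "weight w" "AE x in lebesgue. 0 < w x" and p: "1 \<le> p"
    and a: "\<And>Q. Q \<in> rectangles \<Longrightarrow> 0 < a Q" and SD: "SD s p w a"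
  shows "SD_bound s p w a (SD_norm s p w a)" "1 \<le> SD_norm s p w a"
proof -
  let ?C = "{c. SD_bound s p w a c}"
  have ne: "?C \<noteq> {}" using SD unfolding SD_def by blast
  have ge: "1 \<le> c" if "c \<in> ?C" for c using SD_bound_ge_1[OF w p, of a s c] a that by simp
  show "1 \<le> SD_norm s p w a" unfolding SD_norm_def by (rule cInf_greatest[OF ne ge])
  show "SD_bound s p w a (SD_norm s p w a)"
    unfolding SD_bound_def
  proof (intro ballI allI impI)
    fix R :: "(real ^ 'n) set" and D assume R: "R \<in> rectangles" and D: "D \<subseteq> dyadic_subrects R \<and> disjoint D"
    let ?X = "(\<Sum>\<^sub>\<infinity>Q\<in>D. a Q powr p * (wmeas w Q / wmeas w R)) powr (1 / p)"
    let ?Y = "(measure lebesgue (\<Union>D) / measure lebesgue R) powr (1 / s) * a R"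
    have X: "(\<lambda>Q. a Q powr p * (wmeas w Q / wmeas w R)) summable_on D" "?X \<le> c * ?Y" if "c \<in> ?C" for c
      using that R D unfolding SD_bound_def by (auto simp: mult.assoc)
    obtain c0 where c0: "c0 \<in> ?C" using ne by blast
    have inf: "x \<le> Inf ?C * y" if xy: "\<And>c. c \<in> ?C \<Longrightarrow> x \<le> c * y" and y: "0 \<le> y" for x y :: real
    proof (cases "y = 0")
      case True
      then show ?thesis using xy[OF c0] by simp
    next
      case False
      then have "0 < y" using y by simp
      then have "x / y \<le> Inf ?C"
        using xy by (intro cInf_greatest[OF ne]) (simp add: pos_divide_le_eq)
      then show ?thesis using \<open>0 < y\<close> by (simp add: pos_divide_le_eq)
    qed
    have "?X \<le> Inf ?C * ?Y" by (rule inf[OF X(2)]) (use a[OF R] in auto)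
    then show "(\<lambda>Q. a Q powr p * (wmeas w Q / wmeas w R)) summable_on D \<and>
        ?X \<le> SD_norm s p w a * (measure lebesgue (\<Union>D) / measure lebesgue R) powr (1 / s) * a R"
      using X(1)[OF c0] by (simp add: SD_norm_def mult.assoc)
  qed
qed

text \<open>The inequality \<open>1 + 1 / s \<le> exp (1 / s)\<close>, raised to the power
  \<open>s\<close>. It keeps \<open>c_n\<close> independent of \<open>s\<close>.\<close>

lemma powr_one_plus_inverse_le_exp:
  fixes s :: real
  assumes "0 < s" shows "((1 + s) / s) powr s \<le> exp 1"
proof -
  have "(1 + s) / s = 1 + 1 / s" using assms by (simp add: field_simps)
  also have "\<dots> \<le> exp (1 / s)" by (rule exp_ge_add_one_self)
  finally have "((1 + s) / s) powr s \<le> exp (1 / s) powr s"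
    using assms by (intro powr_mono2) auto
  also have "\<dots> = exp 1" using assms by (simp add: exp_powr_real)
  finally show ?thesis .
qed

section \<open>From mean oscillation to the weighted estimate\<close>

theorem theorem2p1:
  fixes m :: nat
  shows "\<exists>c_n > 0. \<forall>(w :: real ^ 'n \<Rightarrow> real) (p :: real) (s :: real)
           (a :: (real ^ 'n) set \<Rightarrow> real) (f :: real ^ 'n \<Rightarrow> real).
     Ainf_rect w \<longrightarrow> 1 \<le> p \<longrightarrow> 0 < s \<longrightarrow>
     (\<forall>R\<in>rectangles. 0 < a R) \<longrightarrow> SD s p w a \<longrightarrow>
     locally_integrable f \<longrightarrow>
     (\<forall>R\<in>rectangles. avg R (\<lambda>x. \<bar>f x - poly_proj m R f x\<bar>) \<le> a R) \<longrightarrow>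
     (\<forall>R\<in>rectangles.
        set_integrable lebesgue R (\<lambda>x. \<bar>f x - poly_proj m R f x\<bar> powr p * w x) \<and>
        (1 / wmeas w R * (LINT x:R|lebesgue. \<bar>f x - poly_proj m R f x\<bar> powr p * w x)) powr (1 / p)
          \<le> c_n * (1 + s) * max (SD_norm s p w a powr s) 1 * a R)"
proof -
  obtain K where K: "1 \<le> K" and step:
    "\<And>(f :: real ^ 'n \<Rightarrow> real) R t L. locally_integrable f \<Longrightarrow> R \<in> rectangles \<Longrightarrow> 0 < t \<Longrightarrow> 1 \<le> L \<Longrightarrow>
       avg R (\<lambda>x. \<bar>f x - poly_proj m R f x\<bar>) \<le> t \<Longrightarrow>
       \<exists>D. D \<subseteq> dyadic_subrects R \<and> disjoint D \<and> L * measure lebesgue (\<Union>D) \<le> measure lebesgue R \<and>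
         (AE x in lebesgue. x \<in> R - \<Union>D \<longrightarrow> \<bar>f x - poly_proj m R f x\<bar> \<le> K * L * t) \<and>
         (\<forall>Q\<in>D. \<forall>x\<in>Q. \<bar>poly_proj m Q f x - poly_proj m R f x\<bar> \<le> K * L * t)"
    by (rule oscillation_step[of m]) (rule that, assumption+)
  show ?thesis
  \<comment> \<open>\<open>K\<close> is fixed before \<open>w\<close>, \<open>p\<close>,
    \<open>s\<close>, \<open>a\<close> and \<open>f\<close>, for the given dimension and
    \<open>m\<close>; \<open>exp 1\<close> dominates the factor \<open>((1 + s) / s) powr s\<close>
    in \<open>L\<close>.\<close>
  proof (intro exI[of _ "exp 1 * K"] conjI allI impI ballI)
    show "0 < exp 1 * K" using K by simp
  next
    fix w :: "real ^ 'n \<Rightarrow> real" and p s :: real and a :: "(real ^ 'n) set \<Rightarrow> real"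
      and f :: "real ^ 'n \<Rightarrow> real" and R :: "(real ^ 'n) set"
    assume Ainf: "Ainf_rect w" and p: "1 \<le> p" and s: "0 < s" and "\<forall>R\<in>rectangles. 0 < a R"
      and SD: "SD s p w a" and f: "locally_integrable f"
      and "\<forall>R\<in>rectangles. avg R (\<lambda>x. \<bar>f x - poly_proj m R f x\<bar>) \<le> a R"
      and R: "R \<in> rectangles"
    then have a: "\<And>Q. Q \<in> rectangles \<Longrightarrow> 0 < a Q"
      and osc: "\<And>Q. Q \<in> rectangles \<Longrightarrow> avg Q (\<lambda>x. \<bar>f x - poly_proj m Q f x\<bar>) \<le> a Q" by auto
    have w: "weight w" "AE x in lebesgue. 0 < w x"
      using Ainf unfolding Ainf_rect_def Ap_rect_def by auto
    define N where "N = SD_norm s p w a"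
    have N: "SD_bound s p w a N" "1 \<le> N"
      unfolding N_def by (rule SD_bound_SD_norm[OF w p a SD], assumption)+
    \<comment> \<open>Chosen so that \<open>L powr (- 1 / s)\<close> equals
      \<open>\<theta> / N\<close>: the \<open>N\<close> offsets the constant of the SD condition,
      and \<open>\<theta>\<close> is the ratio of a geometric series with sum
      \<open>1 + s\<close>.\<close>
    define \<rho> where "\<rho> = N * ((1 + s) / s)"
    define L where "L = \<rho> powr s"
    define \<theta> where "\<theta> = s / (1 + s)"
    have \<theta>: "0 < \<theta>" "\<theta> < 1" "1 / (1 - \<theta>) = 1 + s" using s by (auto simp: \<theta>_def field_simps)
    have "1 < (1 + s) / s" using s by simp
    then have \<rho>: "1 < \<rho>" unfolding \<rho>_def using mult_mono[of 1 N 1 "(1+s)/s"] N(2)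
      by (metis less_1_mult mult.left_neutral mult.right_neutral order_le_less)
    have L: "1 < L" using \<rho> s by (simp add: L_def)
    have \<rho>\<theta>: "1 / \<rho> = \<theta> / N" by (simp add: \<rho>_def \<theta>_def)
    \<comment> \<open>One selection is fixed for each rectangle, with its own height
      \<open>L * a Q\<close>; on other sets the value may be unspecified.\<close>
    define S where "S Q = (SOME D. D \<subseteq> dyadic_subrects Q \<and> disjoint D \<and> L * measure lebesgue (\<Union>D) \<le> measure lebesgue Q \<and>
         (AE x in lebesgue. x \<in> Q - \<Union>D \<longrightarrow> \<bar>f x - poly_proj m Q f x\<bar> \<le> K * L * a Q) \<and>
         (\<forall>Q'\<in>D. \<forall>x\<in>Q'. \<bar>poly_proj m Q' f x - poly_proj m Q f x\<bar> \<le> K * L * a Q))" for Q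
    have S: "S Q \<subseteq> dyadic_subrects Q \<and> disjoint (S Q) \<and> L * measure lebesgue (\<Union>(S Q)) \<le> measure lebesgue Q \<and>
         (AE x in lebesgue. x \<in> Q - \<Union>(S Q) \<longrightarrow> \<bar>f x - poly_proj m Q f x\<bar> \<le> K * L * a Q) \<and>
         (\<forall>Q'\<in>S Q. \<forall>x\<in>Q'. \<bar>poly_proj m Q' f x - poly_proj m Q f x\<bar> \<le> K * L * a Q)"
      if Q: "Q \<in> rectangles" for Q
      unfolding S_def by (rule someI_ex[OF step[OF f Q a[OF Q] less_imp_le[OF L] osc[OF Q]]])
    interpret stopping_rects S R L
      by unfold_locales (use R L S in blast)+
    let ?G = "generation S R" and ?g = "\<lambda>x. f x - poly_proj m R f x" and ?W = "wmeas w R"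
    have W: "0 < ?W" by (rule wmeas_pos[OF w R])
    have tele: "AE x in lebesgue. x \<in> R \<longrightarrow> (\<exists>n>0. (\<forall>j<n. x \<in> \<Union>(?G j)) \<and>
        \<bar>?g x\<bar> \<le> (\<Sum>j<n. (K * L) * a (gen_rect S R j x)))"
      by (rule AE_telescope[where P = "\<lambda>Q. poly_proj m Q f"]) (use S in blast)+
    have decay: "(\<integral>\<^sup>+Q. ennreal (a Q powr p * wmeas w Q) \<partial>count_space (?G k)) \<le> ennreal ((\<theta> ^ k * a R) powr p * ?W)" for k
    proof -
      let ?t = "\<lambda>Q. a Q powr p * (wmeas w Q / ?W)"
      have sd: "?t summable_on ?G k"
        "infsum ?t (?G k) powr (1 / p) \<le> N * (measure lebesgue (\<Union>(?G k)) / measure lebesgue R) powr (1 / s) * a R"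
        using N(1) R generation_subrects[of k] generation_disjoint[of k] unfolding SD_bound_def by blast+
      have t0: "0 \<le> ?t Q" for Q using wmeas_nonneg[OF w(1)] by simp
      have "infsum ?t (?G k) powr (1 / p) \<le> \<theta> ^ k * a R"
      \<comment> \<open>Generation 0 is treated apart, since there \<open>N ^ k\<close> is 1 and
        cannot absorb the SD constant \<open>N\<close>; its sum is exactly
        \<open>a R powr p\<close>.\<close>
      proof (cases k)
        case 0
        then show ?thesis using W a[OF R] p by (simp add: powr_powr)
      next
        case (Suc i)
        have "measure lebesgue (\<Union>(?G k)) / measure lebesgue R \<le> (1 / L) ^ k"
          using generation_measure[of k] rectangles_measure(2)[OF R] L by (simp add: field_simps power_divide)
        then have "(measure lebesgue (\<Union>(?G k)) / measure lebesgue R) powr (1 / s) \<le> ((1 / L) ^ k) powr (1 / s)"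
          using s by (intro powr_mono2) auto
        also have "\<dots> = (1 / \<rho>) ^ k"
          using \<rho> s by (simp add: L_def powr_powr powr_divide powr_realpow[symmetric] power_divide mult.commute)
        also have "\<dots> = \<theta> ^ k / N ^ k" by (simp add: \<rho>\<theta> power_divide)
        finally have "N * (measure lebesgue (\<Union>(?G k)) / measure lebesgue R) powr (1 / s) * a R \<le> N * (\<theta> ^ k / N ^ k) * a R"
          using N(2) a[OF R] by (intro mult_right_mono mult_left_mono) auto
        \<comment> \<open>One of the \<open>k\<close> factors \<open>N\<close> cancels the SD
          constant; the others are dropped because \<open>1 \<le> N\<close>.\<close>
        also have "\<dots> = \<theta> ^ k / N ^ i * a R" using N(2) by (simp add: Suc)
        also have "\<dots> \<le> \<theta> ^ k * a R"
          using N(2) \<theta> a[OF R] by (intro mult_right_mono) (auto simp: divide_le_eq one_le_power mult_left_le_one_le mult_ge1_I)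
        finally show ?thesis using sd(2) by simp
      qed
      then have "(infsum ?t (?G k) powr (1 / p)) powr p \<le> (\<theta> ^ k * a R) powr p"
        using p by (intro powr_mono2) auto
      moreover have "(infsum ?t (?G k) powr (1 / p)) powr p = infsum ?t (?G k)"
        using p infsum_nonneg[of "?G k" ?t] t0 by (simp add: powr_powr)
      ultimately have le: "infsum ?t (?G k) \<le> (\<theta> ^ k * a R) powr p" by simp
      have "(\<integral>\<^sup>+Q. ennreal (a Q powr p * wmeas w Q) \<partial>count_space (?G k)) = (\<integral>\<^sup>+Q. ennreal ?W * ennreal (?t Q) \<partial>count_space (?G k))"
        using W t0 by (intro nn_integral_cong) (simp add: ennreal_mult'[symmetric])
      also have "\<dots> = ennreal ?W * ennreal (infsum ?t (?G k))"
        unfolding nn_integral_count_space_infsum[OF sd(1) t0, symmetric] by (rule nn_integral_cmult) simp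
      also have "\<dots> = ennreal (infsum ?t (?G k) * ?W)" using W by (simp add: ennreal_mult'[symmetric] mult.commute)
      also have "\<dots> \<le> ennreal ((\<theta> ^ k * a R) powr p * ?W)"
        using W le by (intro ennreal_leI mult_right_mono) auto
      finally show ?thesis .
    qed
    have nn: "(\<integral>\<^sup>+x. ennreal (\<bar>?g x\<bar> powr p * w x) * indicator R x \<partial>lebesgue) \<le>
        ennreal ((K * L * a R / (1 - \<theta>)) powr p * ?W)"
      by (rule generation_sum_weighted[OF R w(1) p a \<theta>(1,2) _ _ generation_subrects _ tele decay])
        (use K L a[OF R] gen_rect_mem in auto)
    define V where "V = K * L * a R * (1 + s)"
    have V: "0 \<le> V" using K L a[OF R] s by (simp add: V_def)
    have nn': "(\<integral>\<^sup>+x. ennreal (indicator R x *\<^sub>R (\<bar>?g x\<bar> powr p * w x)) \<partial>lebesgue) \<le> ennreal (V powr p * ?W)"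
    proof -
      have "(\<integral>\<^sup>+x. ennreal (indicator R x *\<^sub>R (\<bar>?g x\<bar> powr p * w x)) \<partial>lebesgue) =
          (\<integral>\<^sup>+x. ennreal (\<bar>?g x\<bar> powr p * w x) * indicator R x \<partial>lebesgue)"
        by (intro nn_integral_cong) (auto simp: indicator_def)
      moreover have "K * L * a R / (1 - \<theta>) = K * L * a R * (1 / (1 - \<theta>))" by simp
      then have "K * L * a R / (1 - \<theta>) = V" by (simp only: \<theta>(3) V_def)
      ultimately show ?thesis using nn by simp
    qed
    have meas: "(\<lambda>x. indicator R x *\<^sub>R (\<bar>?g x\<bar> powr p * w x)) \<in> borel_measurable lebesgue"
    proof -
      have "set_integrable lebesgue R ?g"
        by (rule set_integral_diff(1)[OF locally_integrable_rectangle[OF f R] set_integrable_polys[OF R poly_proj_polys[OF R]]])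
      then have [measurable]: "(\<lambda>x. indicator R x *\<^sub>R ?g x) \<in> borel_measurable lebesgue"
        unfolding set_integrable_def by (rule borel_measurable_integrable)
      have [measurable]: "(\<lambda>x. indicator R x *\<^sub>R w x) \<in> borel_measurable lebesgue"
        using locally_integrable_rectangle[OF _ R] w(1) by (auto simp: weight_def set_integrable_def)
      \<comment> \<open>Measurability is at hand for the truncations to \<open>R\<close>, so both
        factors carry the indicator.\<close>
      have "(\<lambda>x. \<bar>indicator R x *\<^sub>R ?g x\<bar> powr p * (indicator R x *\<^sub>R w x)) \<in> borel_measurable lebesgue"
        by measurable
      also have "(\<lambda>x. \<bar>indicator R x *\<^sub>R ?g x\<bar> powr p * (indicator R x *\<^sub>R w x)) = (\<lambda>x. indicator R x *\<^sub>R (\<bar>?g x\<bar> powr p * w x))"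
        by (auto simp: indicator_def)
      finally show ?thesis .
    qed
    have pos: "0 \<le> indicator R x *\<^sub>R (\<bar>?g x\<bar> powr p * w x)" for x
      using w(1) by (simp add: weight_def)
    \<comment> \<open>A finite nonnegative integral gives integrability, so the Bochner integral in
      the conclusion is the true value and not the default 0.\<close>
    have int: "set_integrable lebesgue R (\<lambda>x. \<bar>?g x\<bar> powr p * w x)"
      unfolding set_integrable_def
      using nn' by (intro integrableI_nonneg meas AE_I2 pos) (simp add: order_le_less_trans)
    then show "set_integrable lebesgue R (\<lambda>x. \<bar>f x - poly_proj m R f x\<bar> powr p * w x)" .
    have "ennreal (LINT x:R|lebesgue. \<bar>?g x\<bar> powr p * w x) \<le> ennreal (V powr p * ?W)"
      using nn' int pos unfolding set_lebesgue_integral_def set_integrable_def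
      by (subst nn_integral_eq_integral[symmetric]) auto
    then have I: "(LINT x:R|lebesgue. \<bar>?g x\<bar> powr p * w x) \<le> V powr p * ?W"
      using W by (subst (asm) ennreal_le_iff) auto
    have I0: "0 \<le> (LINT x:R|lebesgue. \<bar>?g x\<bar> powr p * w x)"
      unfolding set_lebesgue_integral_def by (intro Bochner_Integration.integral_nonneg pos)
    have "(1 / ?W * (LINT x:R|lebesgue. \<bar>?g x\<bar> powr p * w x)) powr (1 / p) \<le> (V powr p) powr (1 / p)"
      using I I0 W p by (intro powr_mono2) (auto simp: field_simps)
    also have "\<dots> = V" using V p by (simp add: powr_powr)
    also have "V \<le> exp 1 * K * (1 + s) * max (N powr s) 1 * a R"
    proof -
      have "L = N powr s * ((1 + s) / s) powr s"
        using N(2) s unfolding L_def \<rho>_def by (intro powr_mult)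
      also have "\<dots> \<le> max (N powr s) 1 * exp 1"
        using powr_one_plus_inverse_le_exp[OF s] by (intro mult_mono) auto
      finally have "K * a R * (1 + s) * L \<le> K * a R * (1 + s) * (max (N powr s) 1 * exp 1)"
        using K a[OF R] s by (intro mult_left_mono) auto
      then show ?thesis by (simp add: V_def mult_ac)
    qed
    finally show "(1 / wmeas w R * (LINT x:R|lebesgue. \<bar>f x - poly_proj m R f x\<bar> powr p * w x)) powr (1 / p)
          \<le> exp 1 * K * (1 + s) * max (SD_norm s p w a powr s) 1 * a R"
      by (simp add: N_def)
  qed
qed

end
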